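(* Let $P$ be a planar surface. Then the set $\{Q\in\tilde{\mathcal M}:P\rightsquigarrow Q\}$ is compact in the immersive topology on $\tilde{\mathcal M}$. In particular, taking $P$ to be the Euclidean open ball $B_\epsilon$ of radius $\epsilon>0$ centered at $\mathbf 0$ (with basepoint $\mathbf 0$ and developing map the inclusion), the set of planar surfaces into which $B_\epsilon$ immerses is compact.
   Context: Let $\Delta$ be the open oriented topological $2$-disk with basepoint $x_0$. A pointed local homeomorphism is an orientation-preserving local homeomorphism $\phi:\Delta\to\mathbb R^2$ with $\phi(x_0)=\mathbf 0$. Two such maps $\phi,\psi$ are isomorphic if $\psi=\phi\circ h^{-1}$ for some orientation-preserving homeomorphism $h$ of $\Delta$ fixing $x_0$. The moduli space $\tilde{\mathcal M}$ is the set of isomorphism classes; an element $P\in\tilde{\mathcal M}$ is a planar surface, regarded as a topological open disk with basepoint $o_P$ and developing map $\mathrm{dev}_P:P\to\mathbb R^2$, an orientation-preserving local homeomorphism with $\mathrm{dev}_P(o_P)=\mathbf 0$. $\mathrm{PC}(P)$ is the set of path-connected subsets of $P$ containing $o_P$. For $A\in\mathrm{PC}(P)$, $B\in\mathrm{PC}(Q)$, an immersion $\iota:A\rightsquigarrow B$ is a continuous map with $\iota(o_P)=o_Q$ and $\mathrm{dev}_Q\circ\iota=\mathrm{dev}_P$ on $A$; $A\rightsquigarrow B$ means one exists. An embedding is an injective immersion ($\hookrightarrow$). $\overline{\mathrm{Disk}}(P)$: elements of $\mathrm{PC}(P)$ homeomorphic to a closed $2$-disk with $o_P$ in their interior; $\mathrm{Disk}(P)$: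 elements of $\mathrm{PC}(P)$ homeomorphic to an open $2$-disk. The immersive topology on $\tilde{\mathcal M}$ is the coarsest topology in which $\{Q:K\rightsquigarrow Q\}$ is open for every $K\in\overline{\mathrm{Disk}}(P)$ and $\{Q:U\not\hookrightarrow Q\}$ is open for every $U\in\mathrm{Disk}(P)$, over all planar surfaces $P$. *)

theory Defs
  imports "HOL-Analysis.Analysis"
begin

text \<open>The plane R^2 is modelled by the type complex (standard orientation).
  The abstract open oriented disk Delta is modelled by the open unit disk with basepoint 0.\<close>

definition Delta :: "complex set" where
  "Delta = ball 0 1"

definition circ :: "complex \<Rightarrow> real \<Rightarrow> real \<Rightarrow> complex" where
  "circ c r t = c + of_real r * cis (2 * pi * t)"

definition local_homeomorphism :: "complex set \<Rightarrow> (complex \<Rightarrow> complex) \<Rightarrow> bool" where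
  "local_homeomorphism U f \<longleftrightarrow>
     (\<forall>x\<in>U. \<exists>V W g. open V \<and> x \<in> V \<and> V \<subseteq> U \<and> open W \<and> homeomorphism V W f g)"

text \<open>Orientation preservation (local degree +1): the image of a small counterclockwise
  circle around x, on which f is injective, is homotopic in the plane minus f x to
  a counterclockwise circle around f x.\<close>
definition orientation_preserving :: "complex set \<Rightarrow> (complex \<Rightarrow> complex) \<Rightarrow> bool" where
  "orientation_preserving U f \<longleftrightarrow>
     (\<forall>x\<in>U. \<exists>r>0. cball x r \<subseteq> U \<and> inj_on f (cball x r) \<and>
        homotopic_loops (- {f x}) (f \<circ> circ x r) (circ (f x) 1))"

definition pointed_lh :: "(complex \<Rightarrow> complex) \<Rightarrow> bool" where
  "pointed_lh \<phi> \<longleftrightarrow> local_homeomorphism Delta \<phi> \<and> orientation_preserving Delta \<phi> \<and> \<phi> 0 = 0"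

definition iso_plh :: "(complex \<Rightarrow> complex) \<Rightarrow> (complex \<Rightarrow> complex) \<Rightarrow> bool" where
  "iso_plh \<phi> \<psi> \<longleftrightarrow> (\<exists>h k. homeomorphism Delta Delta h k \<and> orientation_preserving Delta h \<and>
       h 0 = 0 \<and> (\<forall>z\<in>Delta. \<psi> z = \<phi> (k z)))"

definition surf :: "(complex \<Rightarrow> complex) \<Rightarrow> (complex \<Rightarrow> complex) set" where
  "surf \<phi> = {\<psi>. pointed_lh \<psi> \<and> iso_plh \<phi> \<psi>}"

definition Mtilde :: "(complex \<Rightarrow> complex) set set" where
  "Mtilde = {surf \<phi> | \<phi>. pointed_lh \<phi>}"

text \<open>Immersion iota from A (developing map f, basepoint 0) into B (developing map g, basepoint 0).\<close>
definition immersion ::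
  "complex set \<Rightarrow> (complex \<Rightarrow> complex) \<Rightarrow> complex set \<Rightarrow> (complex \<Rightarrow> complex) \<Rightarrow> (complex \<Rightarrow> complex) \<Rightarrow> bool" where
  "immersion A f B g \<iota> \<longleftrightarrow> continuous_on A \<iota> \<and> \<iota> ` A \<subseteq> B \<and> \<iota> 0 = 0 \<and> (\<forall>a\<in>A. g (\<iota> a) = f a)"

text \<open>A immerses into the planar surface c (via some, equivalently every, representative).\<close>
definition immerses_into :: "complex set \<Rightarrow> (complex \<Rightarrow> complex) \<Rightarrow> (complex \<Rightarrow> complex) set \<Rightarrow> bool" where
  "immerses_into A f c \<longleftrightarrow> (\<exists>\<psi>\<in>c. \<exists>\<iota>. immersion A f Delta \<psi> \<iota>)"

definition embeds_into :: "complex set \<Rightarrow> (complex \<Rightarrow> complex) \<Rightarrow> (complex \<Rightarrow> complex) set \<Rightarrow> bool" where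
  "embeds_into A f c \<longleftrightarrow> (\<exists>\<psi>\<in>c. \<exists>\<iota>. immersion A f Delta \<psi> \<iota> \<and> inj_on \<iota> A)"

definition closed_disks :: "complex set set" where
  "closed_disks = {K. K \<subseteq> Delta \<and> path_connected K \<and> 0 \<in> K \<and>
      K homeomorphic cball (0::complex) 1 \<and> 0 \<in> interior K}"

definition open_disks :: "complex set set" where
  "open_disks = {U. U \<subseteq> Delta \<and> path_connected U \<and> 0 \<in> U \<and> U homeomorphic ball (0::complex) 1}"

definition immersive_subbasis :: "(complex \<Rightarrow> complex) set set set" where
  "immersive_subbasis =
     {{c \<in> Mtilde. immerses_into K \<phi> c} | \<phi> K. pointed_lh \<phi> \<and> K \<in> closed_disks} \<union>
     {{c \<in> Mtilde. \<not> embeds_into U \<phi> c} | \<phi> U. pointed_lh \<phi> \<and> U \<in> open_disks}"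

definition immersive_topology :: "(complex \<Rightarrow> complex) set topology" where
  "immersive_topology = subtopology (topology_generated_by immersive_subbasis) Mtilde"

end

theory Submission
  imports Defs "HOL-Complex_Analysis.Riemann_Mapping"
begin

text \<open>A surface is recorded by which finite chains of rational boxes, starting at the origin, admit analytic
  continuation of a section of the developing map, and which of these continuations end at common points. At
  every level of resolution there are only finitely many such patterns, so if an open cover had no finite
  subcover, one could choose a nested sequence of patterns none of whose classes is finitely covered.

  The region swept out by the chains of a given level is determined by the pattern, and the decisive point is that
  the region with its holes filled in is contained in the region of a later level that does not depend on the
  surface: the distance to the ideal boundary satisfies a minimum principle, and a horizontal segment
  from any point of a hole reaches the region within a bounded distance. The filled regions are disks by the
  Riemann mapping theorem, and a sequence of surfaces following the chosen patterns embeds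
  each of them into the next. By Brown's theorem their monotone union is a disk, that is, a planar surface. Every
  neighbourhood of it contains one of the classes, which is thus covered by a single open set.\<close>

section \<open>Sections of local homeomorphisms\<close>

text \<open>Equality of patterns controls the swept region up to an isomorphism of developing maps,
  but says nothing about what two surfaces do inside a hole of that region. The holes of one stage
  must therefore be seen to close up at a later one, at a level that serves all surfaces at once:
  only then do surfaces with that later pattern share the filling as well. The slack of the boxes
  provides the uniformity. It keeps the closed region at a definite distance from the ideal
  boundary, and this distance is what survives the passage into the holes. Maps are recovered from
  finite data by continuation: a section over a convex set is determined by one value, and
  immersions carry chains to chains. The two kinds of subbasic sets are treated oppositely. A
  compact disk in the limit already lies in a finite stage, whereas an open disk that embeds into
  members of all the classes embeds into the limit.\<close>

definition etale :: "complex set \<Rightarrow> (complex \<Rightarrow> complex) \<Rightarrow> bool" where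
  "etale A f \<longleftrightarrow> open A \<and> continuous_on A f \<and>
     (\<forall>x\<in>A. \<exists>V. open V \<and> x \<in> V \<and> V \<subseteq> A \<and> inj_on f V)"

definition sec :: "complex set \<Rightarrow> (complex \<Rightarrow> complex) \<Rightarrow> complex set \<Rightarrow> (complex \<Rightarrow> complex) \<Rightarrow> bool" where
  "sec A f B s \<longleftrightarrow> continuous_on B s \<and> s ` B \<subseteq> A \<and> (\<forall>z\<in>B. f (s z) = z)"

text \<open>Invariance of domain supplies the open image and the continuous inverse, so
  \<open>etale\<close> need only ask for local injectivity, a form that passes easily to open
  subsets.\<close>

lemma local_homeomorphism_iff_etale:
  assumes "open U"
  shows "local_homeomorphism U f \<longleftrightarrow> etale U f"
proof
  assume L: "local_homeomorphism U f"
  have "isCont f x" if "x \<in> U" for x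
  proof -
    obtain V W g where "open V" "x \<in> V" "homeomorphism V W f g"
      using L[unfolded local_homeomorphism_def, rule_format, OF \<open>x \<in> U\<close>] by auto
    then show ?thesis
      using continuous_on_eq_continuous_at homeomorphism_cont1 by blast
  qed
  then have "continuous_on U f"
    by (simp add: continuous_at_imp_continuous_on)
  moreover have "\<exists>V. open V \<and> x \<in> V \<and> V \<subseteq> U \<and> inj_on f V" if "x \<in> U" for x
  proof -
    obtain V W g where "open V" "x \<in> V" "V \<subseteq> U" "homeomorphism V W f g"
      using L[unfolded local_homeomorphism_def, rule_format, OF \<open>x \<in> U\<close>] by auto
    moreover from this have "inj_on f V"
      by (metis homeomorphism_apply1 inj_onI)
    ultimately show ?thesis by blast
  qed
  ultimately show "etale U f"
    using assms unfolding etale_def by blast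
next
  assume E: "etale U f"
  show "local_homeomorphism U f"
    unfolding local_homeomorphism_def
  proof
    fix x assume "x \<in> U"
    then obtain V where V: "open V" "x \<in> V" "V \<subseteq> U" "inj_on f V"
      using E unfolding etale_def by meson
    have c: "continuous_on V f"
      using E V continuous_on_subset unfolding etale_def by blast
    obtain g where "homeomorphism V (f ` V) f g"
      using invariance_of_domain_homeomorphism[OF V(1) c _ V(4)] by auto
    moreover have "open (f ` V)"
      using invariance_of_domain[OF c V(1) V(4)] .
    ultimately show "\<exists>V W g. open V \<and> x \<in> V \<and> V \<subseteq> U \<and> open W \<and> homeomorphism V W f g"
      using V by blast
  qed
qed

text \<open>The set where the two lifts agree is closed by continuity and open because
  \<open>p\<close> is injective near each value.\<close>

lemma unique_lift:
  fixes f g :: "'a::topological_space \<Rightarrow> complex"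
  assumes E: "etale A p" and X: "connected X"
    and cf: "continuous_on X f" and cg: "continuous_on X g"
    and fA: "f ` X \<subseteq> A" and gA: "g ` X \<subseteq> A"
    and eq: "\<And>x. x \<in> X \<Longrightarrow> p (f x) = p (g x)"
    and x0: "x0 \<in> X" "f x0 = g x0" and x: "x \<in> X"
  shows "f x = g x"
proof -
  let ?E = "{x \<in> X. f x = g x}"
  have "closedin (top_of_set X) {x \<in> X. f x - g x = 0}"
    by (intro continuous_closedin_preimage_constant continuous_on_diff cf cg)
  then have cl: "closedin (top_of_set X) ?E" by simp
  have op: "openin (top_of_set X) ?E"
  proof (subst openin_subopen, clarify)
    fix y assume y: "y \<in> X" "f y = g y"
    then obtain V where V: "open V" "f y \<in> V" "V \<subseteq> A" "inj_on p V"
      using E fA unfolding etale_def by (metis image_subset_iff)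
    have "openin (top_of_set X) ((X \<inter> f -` V) \<inter> (X \<inter> g -` V))"
      by (intro openin_Int continuous_openin_preimage_gen cf cg V)
    moreover have "(X \<inter> f -` V) \<inter> (X \<inter> g -` V) \<subseteq> ?E"
      using eq V(4) by (auto dest: inj_onD)
    ultimately show "\<exists>T. openin (top_of_set X) T \<and> y \<in> T \<and> T \<subseteq> ?E"
      using y V by (intro exI[of _ "(X \<inter> f -` V) \<inter> (X \<inter> g -` V)"]) auto
  qed
  from X cl op have "?E = {} \<or> ?E = X"
    unfolding connected_clopen by blast
  then show ?thesis using x0 x by blast
qed

lemma sec_unique:
  assumes "etale A p" "connected B" "sec A p B s" "sec A p B s'" "z0 \<in> B" "s z0 = s' z0" "z \<in> B"
  shows "s z = s' z"
  using assms unique_lift[of A p B s s' z0 z] unfolding sec_def by auto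

lemma sec_subset: "sec A p B s \<Longrightarrow> C \<subseteq> B \<Longrightarrow> sec A p C s"
  unfolding sec_def using continuous_on_subset by blast

text \<open>Convex domains are used because their intersections are connected: one common value
  forces agreement on the whole overlap. The later gluings of sections rest on this.\<close>

lemma sec_unique_Int:
  assumes "etale A p" "convex B" "convex C" "sec A p B s" "sec A p C s'"
    and "z0 \<in> B \<inter> C" "s z0 = s' z0" "z \<in> B \<inter> C"
  shows "s z = s' z"
proof (rule sec_unique[of A p "B \<inter> C" s s' z0])
  show "connected (B \<inter> C)" using assms by (simp add: convex_Int convex_connected)
  show "sec A p (B \<inter> C) s" using sec_subset[OF assms(4)] by simp
  show "sec A p (B \<inter> C) s'" using sec_subset[OF assms(5)] by simp
qed (use assms sec_subset in auto)

lemma local_section: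
  assumes "etale A p" "x \<in> A"
  obtains e s where "e > 0" "sec A p (ball (p x) e) s" "s (p x) = x"
proof -
  obtain V where V: "open V" "x \<in> V" "V \<subseteq> A" "inj_on p V"
    using assms unfolding etale_def by meson
  have c: "continuous_on V p"
    using assms V continuous_on_subset unfolding etale_def by blast
  obtain g where g: "homeomorphism V (p ` V) p g"
    using invariance_of_domain_homeomorphism[OF V(1) c _ V(4)] by auto
  have "open (p ` V)"
    using invariance_of_domain[OF c V(1) V(4)] .
  then obtain e where e: "e > 0" "ball (p x) e \<subseteq> p ` V"
    using V(2) open_contains_ball by blast
  have "sec A p (p ` V) g"
    using g V(3) unfolding sec_def homeomorphism_def by auto
  then have "sec A p (ball (p x) e) g"
    using e sec_subset by blast
  moreover have "g (p x) = x"
    using g V(2) homeomorphism_apply1 by blast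
  ultimately show ?thesis using that e(1) by blast
qed

lemma sec_inj: "sec A p B s \<Longrightarrow> inj_on s B"
  unfolding sec_def by (metis inj_onI)

lemma sec_open: "sec A p B s \<Longrightarrow> open B \<Longrightarrow> open (s ` B)"
  using invariance_of_domain sec_inj unfolding sec_def by blast

lemma sec_glue:
  assumes op: "\<And>i. i \<in> I \<Longrightarrow> open (B i)" and s: "\<And>i. i \<in> I \<Longrightarrow> sec A p (B i) (s i)"
    and agree: "\<And>i j z. i \<in> I \<Longrightarrow> j \<in> I \<Longrightarrow> z \<in> B i \<Longrightarrow> z \<in> B j \<Longrightarrow> s i z = s j z"
  obtains t where "sec A p (\<Union>i\<in>I. B i) t" "\<And>i z. i \<in> I \<Longrightarrow> z \<in> B i \<Longrightarrow> t z = s i z"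
proof -
  define t where "t z = s (SOME i. i \<in> I \<and> z \<in> B i) z" for z
  have t: "t z = s i z" if "i \<in> I" "z \<in> B i" for i z
    unfolding t_def using agree that by (metis (mono_tags, lifting) someI_ex)
  have "continuous_on (B i) t" if "i \<in> I" for i
    using s[OF that] t that unfolding sec_def by (auto cong: continuous_on_cong)
  then have "continuous_on (\<Union>i\<in>I. B i) t"
    by (intro continuous_on_open_UN op)
  then have "sec A p (\<Union>i\<in>I. B i) t"
    using s t unfolding sec_def by fastforce
  then show ?thesis using that t by blast
qed

lemma sec_glue2:
  assumes "open B" "open C" "sec A p B s" "sec A p C s'"
    and "\<And>z. z \<in> B \<Longrightarrow> z \<in> C \<Longrightarrow> s z = s' z"
  obtains t where "sec A p (B \<union> C) t" "\<And>z. z \<in> B \<Longrightarrow> t z = s z" "\<And>z. z \<in> C \<Longrightarrow> t z = s' z"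
proof -
  obtain t where "sec A p (\<Union>i\<in>{True,False}. if i then B else C) t"
      "\<And>i z. i \<in> {True,False} \<Longrightarrow> z \<in> (if i then B else C) \<Longrightarrow> t z = (if i then s else s') z"
    by (rule sec_glue[of "{True,False}" "\<lambda>i. if i then B else C" A p "\<lambda>i. if i then s else s'"])
       (use assms in auto)
  from this(1) this(2)[of True] this(2)[of False] show ?thesis
    using that by (simp add: Un_commute)
qed

text \<open>On the sheet of \<open>s i\<close> the map has to be \<open>s' i\<close> after
  \<open>p\<close>. Compatibility is asked only where the given sections coincide, so distinct
  sheets over the same points of the plane are left free.\<close>

lemma glue_immersion:
  assumes op: "\<And>i. i \<in> I \<Longrightarrow> open (B i)"
    and s: "\<And>i. i \<in> I \<Longrightarrow> sec A p (B i) (s i)"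
    and s': "\<And>i. i \<in> I \<Longrightarrow> sec A' p' (B i) (s' i)"
    and agree: "\<And>i j z. i \<in> I \<Longrightarrow> j \<in> I \<Longrightarrow> z \<in> B i \<Longrightarrow> z \<in> B j \<Longrightarrow> s i z = s j z \<Longrightarrow> s' i z = s' j z"
  obtains \<iota> where "continuous_on (\<Union>i\<in>I. s i ` B i) \<iota>" "\<iota> ` (\<Union>i\<in>I. s i ` B i) \<subseteq> A'"
    "\<And>x. x \<in> (\<Union>i\<in>I. s i ` B i) \<Longrightarrow> p' (\<iota> x) = p x"
    "\<And>i z. i \<in> I \<Longrightarrow> z \<in> B i \<Longrightarrow> \<iota> (s i z) = s' i z"
proof -
  define \<iota> where "\<iota> x = s' (SOME i. i \<in> I \<and> x \<in> s i ` B i) (p x)" for x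
  have ps: "p (s i z) = z" if "i \<in> I" "z \<in> B i" for i z
    using s that unfolding sec_def by blast
  have val: "\<iota> (s i z) = s' i z" if iz: "i \<in> I" "z \<in> B i" for i z
  proof -
    let ?j = "SOME j. j \<in> I \<and> s i z \<in> s j ` B j"
    have j: "?j \<in> I \<and> s i z \<in> s ?j ` B ?j"
      by (rule someI[of _ i]) (use iz in auto)
    then obtain w where w: "w \<in> B ?j" "s i z = s ?j w" by blast
    then have "w = z" using ps iz j by metis
    then have "s' ?j z = s' i z" using agree[of ?j i z] j iz w by metis
    then show ?thesis unfolding \<iota>_def using ps[OF iz] by simp
  qed
  have "continuous_on (s i ` B i) \<iota>" if "i \<in> I" for i
  proof -
    \<comment> \<open>On the sheet, \<open>p\<close> inverts the section, and invariance of domain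
      makes this inverse continuous.\<close>
    have h: "continuous_on (s i ` B i) p"
    proof -
      obtain g where g: "homeomorphism (B i) (s i ` B i) (s i) g"
        using invariance_of_domain_homeomorphism[of "B i" "s i"] op[OF \<open>i \<in> I\<close>] s[OF \<open>i \<in> I\<close>] sec_inj[OF s[OF \<open>i \<in> I\<close>]]
        unfolding sec_def by auto
      have "g x = p x" if x: "x \<in> s i ` B i" for x
      proof -
        obtain z where z: "z \<in> B i" "x = s i z" using x by blast
        then have "g x = z" using g homeomorphism_apply1 by metis
        then show ?thesis using z ps[OF \<open>i \<in> I\<close>] by simp
      qed
      then show ?thesis
        using homeomorphism_cont2[OF g] by (simp cong: continuous_on_cong)
    qed
    have img: "p ` (s i ` B i) = B i" using ps[OF that] by (auto simp: image_iff)
    have "continuous_on (s i ` B i) (s' i \<circ> p)"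
      by (rule continuous_on_compose[OF h]) (use s'[OF that] img in \<open>simp add: sec_def\<close>)
    moreover have "\<iota> x = (s' i \<circ> p) x" if "x \<in> s i ` B i" for x
      using that val ps \<open>i \<in> I\<close> by auto
    ultimately show ?thesis by (simp cong: continuous_on_cong)
  qed
  then have "continuous_on (\<Union>i\<in>I. s i ` B i) \<iota>"
    using s op sec_open by (intro continuous_on_open_UN) blast+
  moreover have "\<iota> ` (\<Union>i\<in>I. s i ` B i) \<subseteq> A'"
    using val s' unfolding sec_def by fastforce
  moreover have "p' (\<iota> x) = p x" if "x \<in> (\<Union>i\<in>I. s i ` B i)" for x
    using that val s' ps unfolding sec_def by fastforce
  ultimately show ?thesis using that val by blast
qed

section \<open>Chains of boxes\<close>

datatype box_data = Box int int int int nat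

instance box_data :: countable
proof (rule countable_classI[of "\<lambda>b. case b of Box i j i' j' n \<Rightarrow> to_nat (i, j, i', j', n)"])
qed (auto split: box_data.splits)

text \<open>The open neighbourhood of radius \<open>\<rho>\<close>, in the maximum norm, of the
  horizontal segment of length \<open>T\<close> starting at \<open>w\<close>; for
  \<open>T = 0\<close> an open square.\<close>

definition rect :: "complex \<Rightarrow> real \<Rightarrow> real \<Rightarrow> complex set" where
  "rect w T \<rho> = {z. Re w - \<rho> < Re z \<and> Re z < Re w + T + \<rho> \<and> Im w - \<rho> < Im z \<and> Im z < Im w + \<rho>}"

text \<open>The corners lie on the grid of mesh \<open>1 / (n + 1)\<close>, so there are only countably many boxes.\<close>
primrec bx :: "real \<Rightarrow> box_data \<Rightarrow> complex set" where
  "bx \<eta> (Box i j i' j' n) = {z. of_int i / (real n + 1) - \<eta> < Re z \<and> Re z < of_int i' / (real n + 1) + \<eta> \<and>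
     of_int j / (real n + 1) - \<eta> < Im z \<and> Im z < of_int j' / (real n + 1) + \<eta>}"

lemma rect_eq_box: "rect w T \<rho> = box (Complex (Re w - \<rho>) (Im w - \<rho>)) (Complex (Re w + T + \<rho>) (Im w + \<rho>))"
  unfolding rect_def by (auto simp: in_box_complex_iff)

lemma open_rect [simp]: "open (rect w T \<rho>)" and convex_rect [simp]: "convex (rect w T \<rho>)"
  unfolding rect_eq_box by (auto simp: open_box convex_box)

lemma bx_eq_box: "\<exists>u v. \<forall>\<eta>. bx \<eta> b = box (u - Complex \<eta> \<eta>) (v + Complex \<eta> \<eta>)"
proof -
  obtain i j i' j' n where b: "b = Box i j i' j' n" by (cases b)
  show ?thesis
    by (rule exI[of _ "Complex (of_int i / (real n + 1)) (of_int j / (real n + 1))"],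
        rule exI[of _ "Complex (of_int i' / (real n + 1)) (of_int j' / (real n + 1))"])
       (auto simp: b in_box_complex_iff)
qed

lemma open_bx [simp]: "open (bx \<eta> b)" and convex_bx [simp]: "convex (bx \<eta> b)"
    and bounded_bx [simp]: "bounded (bx \<eta> b)"
  using bx_eq_box[of b] by (metis open_box convex_box bounded_box)+

lemma bx_mono: "\<eta> \<le> \<eta>' \<Longrightarrow> bx \<eta> b \<subseteq> bx \<eta>' b"
  by (cases b) auto

text \<open>This is how slack becomes distance to the ideal boundary: a section on the enlarged box
  is defined on a whole square around each point of the closed box.\<close>

lemma rect_subset_bx:
  assumes "z \<in> closure (bx 0 b)" shows "rect z 0 \<eta> \<subseteq> bx \<eta> b"
proof -
  obtain u v where uv: "\<And>\<eta>. bx \<eta> b = box (u - Complex \<eta> \<eta>) (v + Complex \<eta> \<eta>)"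
    using bx_eq_box by metis
  have "closure (bx 0 b) \<subseteq> cbox u v"
    using uv[of 0] closure_minimal[of "box u v" "cbox u v"] box_subset_cbox[of u v]
    by (simp add: zero_complex.code[symmetric] Complex_eq_0 closed_cbox)
  then have "z \<in> cbox u v" using assms by blast
  then show ?thesis
    unfolding uv rect_def by (auto simp: in_box_complex_iff in_cbox_complex_iff)
qed

lemma closure_bx_subset: "0 < \<eta> \<Longrightarrow> closure (bx 0 b) \<subseteq> bx \<eta> b"
  using rect_subset_bx[of _ b \<eta>] unfolding rect_def by fastforce

lemma rect_subset_ball: "rect w 0 (e / 2) \<subseteq> ball w e"
proof
  fix z assume z: "z \<in> rect w 0 (e / 2)"
  have "norm (z - w) \<le> \<bar>Re (z - w)\<bar> + \<bar>Im (z - w)\<bar>" by (rule cmod_le)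
  also have "\<dots> < e / 2 + e / 2"
    using z unfolding rect_def by (intro add_strict_mono) (auto simp only: abs_less_iff mem_Collect_eq complex.sel minus_complex.sel)
  finally show "z \<in> ball w e" by (simp add: dist_norm norm_minus_commute)
qed

text \<open>Replaces a real rectangle by one of finitely many grid boxes depending only on
  \<open>\<rho>\<close> and \<open>M\<close>. This finiteness makes the later level in
  \<open>fill_region\<close> independent of the surface.\<close>

lemma round_to_box:
  assumes "\<rho> > 0"
  obtains h where "h > 0"
    "\<And>M. \<exists>G. finite G \<and> (\<forall>w T. 0 \<le> T \<longrightarrow> \<bar>Re w\<bar> \<le> M \<longrightarrow> \<bar>Im w\<bar> \<le> M \<longrightarrow> Re w + T \<le> M \<longrightarrow>
       (\<exists>b\<in>G. (\<forall>t\<in>{0..T}. w + of_real t \<in> bx 0 b) \<and> bx h b \<subseteq> rect w T \<rho>))"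
proof -
  \<comment> \<open>Rounding moves a lower edge outward by at most two mesh widths and an upper one
    by at most one; the enlargement by \<open>d\<close> costs one more, so three mesh widths must
    stay below \<open>\<rho>\<close>.\<close>
  obtain N :: nat where N: "3 / \<rho> < real N + 1"
    using reals_Archimedean2[of "3 / \<rho>"] by (metis add.commute less_add_same_cancel1 less_trans zero_less_one)
  define n where "n = real N + 1"
  have n: "n > 0" unfolding n_def by simp
  define d where "d = 1 / n"
  have d: "d > 0" unfolding d_def using n by simp
  have n3: "3 * d < \<rho>" using N n assms unfolding n_def[symmetric] d_def by (simp add: field_simps)
  have "\<exists>G. finite G \<and> (\<forall>w T. 0 \<le> T \<longrightarrow> \<bar>Re w\<bar> \<le> M \<longrightarrow> \<bar>Im w\<bar> \<le> M \<longrightarrow> Re w + T \<le> M \<longrightarrow>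
       (\<exists>b\<in>G. (\<forall>t\<in>{0..T}. w + of_real t \<in> bx 0 b) \<and> bx d b \<subseteq> rect w T \<rho>))" for M
  proof -
    define J where "J = {\<lfloor>- M * n\<rfloor> - 1 .. \<lfloor>M * n\<rfloor> + 1}"
    define G where "G = (\<lambda>(i, j, i', j'). Box i j i' j' N) ` (J \<times> J \<times> J \<times> J)"
    have "finite G" unfolding J_def G_def by simp
    moreover have "\<exists>b\<in>G. (\<forall>t\<in>{0..T}. w + of_real t \<in> bx 0 b) \<and> bx d b \<subseteq> rect w T \<rho>"
      if T: "0 \<le> T" and M: "\<bar>Re w\<bar> \<le> M" "\<bar>Im w\<bar> \<le> M" "Re w + T \<le> M" for w T
    proof -
      have inJ: "\<lfloor>x * n\<rfloor> - 1 \<in> J" "\<lfloor>x * n\<rfloor> + 1 \<in> J" if "\<bar>x\<bar> \<le> M" for x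
      proof -
        have "- M \<le> x" "x \<le> M" using that by auto
        then have "- M * n \<le> x * n" "x * n \<le> M * n" using n mult_right_mono[of "- M" x n] mult_right_mono[of x M n] by auto
        then have "\<lfloor>- M * n\<rfloor> \<le> \<lfloor>x * n\<rfloor>" "\<lfloor>x * n\<rfloor> \<le> \<lfloor>M * n\<rfloor>" by (auto intro: floor_mono)
        then show "\<lfloor>x * n\<rfloor> - 1 \<in> J" "\<lfloor>x * n\<rfloor> + 1 \<in> J" unfolding J_def by auto
      qed
      let ?b = "Box (\<lfloor>Re w * n\<rfloor> - 1) (\<lfloor>Im w * n\<rfloor> - 1) (\<lfloor>(Re w + T) * n\<rfloor> + 1) (\<lfloor>Im w * n\<rfloor> + 1) N"
      have lo: "x - 2 * d \<le> of_int (\<lfloor>x * n\<rfloor> - 1) / n" "of_int (\<lfloor>x * n\<rfloor> - 1) / n < x"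
        and hi: "x < of_int (\<lfloor>x * n\<rfloor> + 1) / n" "of_int (\<lfloor>x * n\<rfloor> + 1) / n \<le> x + d" for x
      proof -
        have f: "of_int \<lfloor>x * n\<rfloor> \<le> x * n" "x * n < of_int \<lfloor>x * n\<rfloor> + 1"
          using floor_correct[of "x * n"] by auto
        have "(x - 2 * d) * n = x * n - 2" "(x + d) * n = x * n + 1"
          using n unfolding d_def by (simp_all add: left_diff_distrib distrib_right)
        then have "(x - 2 * d) * n \<le> of_int (\<lfloor>x * n\<rfloor> - 1)" "of_int (\<lfloor>x * n\<rfloor> - 1) < x * n"
          "x * n < of_int (\<lfloor>x * n\<rfloor> + 1)" "of_int (\<lfloor>x * n\<rfloor> + 1) \<le> (x + d) * n"
          unfolding of_int_diff of_int_add of_int_1 using f by linarith+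
        then show "x - 2 * d \<le> of_int (\<lfloor>x * n\<rfloor> - 1) / n" "of_int (\<lfloor>x * n\<rfloor> - 1) / n < x"
          "x < of_int (\<lfloor>x * n\<rfloor> + 1) / n" "of_int (\<lfloor>x * n\<rfloor> + 1) / n \<le> x + d"
          unfolding pos_le_divide_eq[OF n] pos_divide_le_eq[OF n] pos_less_divide_eq[OF n] pos_divide_less_eq[OF n] .
      qed
      have "?b \<in> G" unfolding G_def
        using inJ[of "Re w"] inJ[of "Im w"] inJ[of "Re w + T"] M T
        by (intro image_eqI[where x = "(\<lfloor>Re w * n\<rfloor> - 1, \<lfloor>Im w * n\<rfloor> - 1, \<lfloor>(Re w + T) * n\<rfloor> + 1, \<lfloor>Im w * n\<rfloor> + 1)"]) auto
      moreover have "w + of_real t \<in> bx 0 ?b" if "t \<in> {0..T}" for t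
        unfolding bx.simps n_def[symmetric] mem_Collect_eq plus_complex.sel Re_complex_of_real Im_complex_of_real
        using lo(2)[of "Re w"] lo(2)[of "Im w"] hi(1)[of "Re w + T"] hi(1)[of "Im w"] that by simp
      moreover have "bx d ?b \<subseteq> rect w T \<rho>"
        unfolding bx.simps n_def[symmetric] rect_def
        using lo(1)[of "Re w"] lo(1)[of "Im w"] hi(2)[of "Re w + T"] hi(2)[of "Im w"] d n3
        by (intro Collect_mono impI conjI; elim conjE; linarith)
      ultimately show ?thesis by blast
    qed
    ultimately show ?thesis by blast
  qed
  then show ?thesis using that[of d] d by simp
qed

text \<open>The head of the list is the last box. Consecutive boxes must overlap before the enlargement by \<open>\<eta>\<close>, but the
  sections live on the enlarged boxes; this slack controls closures of the regions below.\<close>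
fun chain :: "complex set \<Rightarrow> (complex \<Rightarrow> complex) \<Rightarrow> real \<Rightarrow> box_data list \<Rightarrow> (complex \<Rightarrow> complex) \<Rightarrow> bool" where
  "chain A p \<eta> [] s \<longleftrightarrow> False"
| "chain A p \<eta> [b] s \<longleftrightarrow> 0 \<in> bx 0 b \<and> sec A p (bx \<eta> b) s \<and> s 0 = 0"
| "chain A p \<eta> (b # b' # l) s \<longleftrightarrow> sec A p (bx \<eta> b) s \<and>
     (\<exists>s'. chain A p \<eta> (b' # l) s' \<and> (\<exists>z\<in>bx 0 b \<inter> bx 0 b'. s z = s' z))"

lemma chain_sec: "chain A p \<eta> l s \<Longrightarrow> sec A p (bx \<eta> (hd l)) s"
  by (induction A p \<eta> l s rule: chain.induct) auto

lemma chain_Nil: "chain A p \<eta> l s \<Longrightarrow> l \<noteq> []"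
  by (cases l) auto

lemma chain_mono: "chain A p \<eta> l s \<Longrightarrow> \<eta>' \<le> \<eta> \<Longrightarrow> chain A p \<eta>' l s"
proof (induction A p \<eta> l s rule: chain.induct)
  case (2 A p \<eta> b s)
  then show ?case using sec_subset bx_mono by (metis chain.simps(2))
next
  case (3 A p \<eta> b b' l s)
  have "sec A p (bx \<eta>' b) s"
    using 3 sec_subset[OF _ bx_mono] by (metis chain.simps(3))
  then show ?case using 3 by (auto simp del: chain.simps(1,2))
qed auto

text \<open>A chain is a discrete path and its section the continuation along it: the previous
  sections agree by induction, hence the new ones agree at a point of the overlap and then on the
  whole box.\<close>

lemma chain_unique:
  assumes E: "etale A p" and \<eta>: "0 \<le> \<eta>"
  shows "chain A p \<eta> l s \<Longrightarrow> chain A p \<eta> l s' \<Longrightarrow> z \<in> bx \<eta> (hd l) \<Longrightarrow> s z = s' z"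
proof (induction l arbitrary: s s' z rule: induct_list012)
  case (2 b)
  have "(0::complex) \<in> bx \<eta> b" using 2(1) subsetD[OF bx_mono[OF \<eta>, of b]] by simp
  then show ?case
    using sec_unique[OF E convex_connected[OF convex_bx], of \<eta> b s s' 0 z] 2 by simp
next
  case (3 b b' l)
  obtain t u where t: "chain A p \<eta> (b' # l) t" "u \<in> bx 0 b \<inter> bx 0 b'" "s u = t u"
    using 3 by auto
  obtain t' u' where t': "chain A p \<eta> (b' # l) t'" "u' \<in> bx 0 b \<inter> bx 0 b'" "s' u' = t' u'"
    using 3 by auto
  have s: "sec A p (bx \<eta> b) s" "sec A p (bx \<eta> b) s'" using 3 by auto
  have tt: "t x = t' x" if "x \<in> bx \<eta> b'" for x
    using 3(2)[OF t(1) t'(1)] that by simp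
  have mem: "u \<in> bx \<eta> b \<inter> bx \<eta> b'" "u' \<in> bx \<eta> b \<inter> bx \<eta> b'"
    using t(2) t'(2) bx_mono[OF \<eta>] by blast+
  have st: "sec A p (bx \<eta> b') t"
    using chain_sec[OF t(1)] by simp
  have "s u' = t u'"
    using sec_unique_Int[OF E _ _ s(1) st mem(1) t(3) mem(2)] by simp
  then have "s u' = s' u'" using tt[of u'] t'(3) mem by simp
  then show ?case
    using sec_unique[OF E convex_connected[OF convex_bx] s, of u' z] mem 3(5) by simp
qed auto

lemma chain_extend:
  assumes "chain A p \<eta> l s" "sec A p (bx \<eta> b) t" "z \<in> bx 0 b" "z \<in> bx 0 (hd l)" "t z = s z"
  shows "chain A p \<eta> (b # l) t"
  using assms by (cases l) auto

text \<open>An immersion commutes with the developing maps, so composing with it turns sections into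
  sections over the same boxes.\<close>

lemma chain_push:
  assumes "immersion A p A' p' \<iota>" "0 \<le> \<eta>"
  shows "chain A p \<eta> l s \<Longrightarrow> chain A' p' \<eta> l (\<iota> \<circ> s)"
proof (induction l arbitrary: s rule: induct_list012)
  have sec: "sec A' p' B (\<iota> \<circ> s)" if "sec A p B s" for B s
    using that assms(1) continuous_on_compose[of B s \<iota>] continuous_on_subset[of A \<iota> "s ` B"]
    unfolding sec_def immersion_def by auto
  {
    case (2 b)
    then show ?case using assms(1) sec[of "bx \<eta> b" s] by (simp add: immersion_def del: o_apply) (simp add: o_def)
  next
    case (3 b b' l)
    then obtain s' z where "chain A p \<eta> (b' # l) s'" "z \<in> bx 0 b \<inter> bx 0 b'" "s z = s' z" by auto
    then have "chain A' p' \<eta> (b' # l) (\<iota> \<circ> s')" "(\<iota> \<circ> s) z = (\<iota> \<circ> s') z"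
      using 3(2)[of s'] by (auto simp: o_def)
    moreover have "sec A' p' (bx \<eta> b) (\<iota> \<circ> s)" using 3(3) sec by simp
    ultimately show ?case using \<open>z \<in> bx 0 b \<inter> bx 0 b'\<close> unfolding chain.simps by blast
  }
qed auto

text \<open>One number bounds the indices of the boxes, the length and, inversely, the slack. The
  candidates at each level form a finite set common to all surfaces, and levels increase with
  \<open>k\<close>.\<close>

definition level_chains :: "complex set \<Rightarrow> (complex \<Rightarrow> complex) \<Rightarrow> nat \<Rightarrow> box_data list set" where
  "level_chains A p k = {l. set l \<subseteq> from_nat ` {..<k} \<and> length l \<le> k \<and> (\<exists>s. chain A p (1 / (real k + 1)) l s)}"

text \<open>With slack \<open>0\<close> the choice does not depend on the level, and for an
  \<open>etale\<close> map \<open>chain_unique\<close> makes its values on the unenlarged last box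
  canonical; only these are used.\<close>

definition csec :: "complex set \<Rightarrow> (complex \<Rightarrow> complex) \<Rightarrow> box_data list \<Rightarrow> complex \<Rightarrow> complex" where
  "csec A p l = (SOME s. chain A p 0 l s)"

definition region :: "complex set \<Rightarrow> (complex \<Rightarrow> complex) \<Rightarrow> nat \<Rightarrow> complex set" where
  "region A p k = (\<Union>l\<in>level_chains A p k. csec A p l ` bx 0 (hd l))"

text \<open>Two continuations end on the same sheet. One common point is enough, since the two boxes
  overlap in a connected set.\<close>

definition meets :: "complex set \<Rightarrow> (complex \<Rightarrow> complex) \<Rightarrow> box_data list \<Rightarrow> box_data list \<Rightarrow> bool" where
  "meets A p l l' \<longleftrightarrow> (\<exists>z\<in>bx 0 (hd l) \<inter> bx 0 (hd l'). csec A p l z = csec A p l' z)"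

text \<open>The gluing data of the region: its sheets, and which of them coincide over their
  overlap.\<close>

definition pattern :: "complex set \<Rightarrow> (complex \<Rightarrow> complex) \<Rightarrow> nat \<Rightarrow> box_data list set \<times> (box_data list \<times> box_data list) set" where
  "pattern A p k = (level_chains A p k, {(l, l'). l \<in> level_chains A p k \<and> l' \<in> level_chains A p k \<and> meets A p l l'})"

lemma finite_patterns: "finite {pattern A p k |A p. True}"
proof -
  let ?L = "{l :: box_data list. set l \<subseteq> from_nat ` {..<k} \<and> length l \<le> k}"
  have "finite ?L" by (intro finite_lists_length_le) simp
  then have "finite (Pow ?L \<times> Pow (?L \<times> ?L))" by simp
  moreover have "{pattern A p k |A p. True} \<subseteq> Pow ?L \<times> Pow (?L \<times> ?L)"
    unfolding pattern_def level_chains_def by auto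
  ultimately show ?thesis by (rule finite_subset[rotated])
qed

lemma chain_csec: "chain A p \<eta> l s \<Longrightarrow> 0 \<le> \<eta> \<Longrightarrow> chain A p 0 l (csec A p l)"
  unfolding csec_def using chain_mono by (metis someI_ex)

lemma csec_eq:
  assumes "etale A p" "chain A p \<eta> l s" "0 \<le> \<eta>" "z \<in> bx 0 (hd l)"
  shows "csec A p l z = s z"
  using assms chain_unique[OF assms(1) order_refl] chain_csec chain_mono by blast

lemma chains_csec: "l \<in> level_chains A p k \<Longrightarrow> chain A p 0 l (csec A p l)"
  unfolding level_chains_def using chain_csec by fastforce

lemma chains_sec: "l \<in> level_chains A p k \<Longrightarrow> sec A p (bx 0 (hd l)) (csec A p l)"
  using chains_csec chain_sec by blast

lemma chains_tl:
  assumes "b # b' # l \<in> level_chains A p k" shows "b' # l \<in> level_chains A p k"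
  using assms unfolding level_chains_def by auto

lemma chains_mono: "k \<le> k' \<Longrightarrow> level_chains A p k \<subseteq> level_chains A p k'"
proof
  fix l assume k: "k \<le> k'" and l: "l \<in> level_chains A p k"
  then obtain s where "chain A p (1 / (real k + 1)) l s" unfolding level_chains_def by blast
  moreover have "1 / (real k' + 1) \<le> 1 / (real k + 1)" using k by (simp add: frac_le)
  ultimately have "chain A p (1 / (real k' + 1)) l s" using chain_mono by blast
  moreover have "from_nat ` {..<k} \<subseteq> (from_nat ` {..<k'} :: box_data set)" using k by (intro image_mono) auto
  ultimately show "l \<in> level_chains A p k'" using l k unfolding level_chains_def by fastforce
qed

lemma region_mono: "k \<le> k' \<Longrightarrow> region A p k \<subseteq> region A p k'"
  unfolding region_def using chains_mono by (intro UN_mono) blast+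

lemma region_subset: "region A p k \<subseteq> A"
  unfolding region_def using chains_sec unfolding sec_def by blast

lemma open_region [simp]: "open (region A p k)"
  unfolding region_def by (intro open_UN ballI sec_open[OF chains_sec]) simp_all

lemma meets_agree:
  assumes "etale A p" "l \<in> level_chains A p k" "l' \<in> level_chains A p k'" "meets A p l l'"
    and "z \<in> bx 0 (hd l)" "z \<in> bx 0 (hd l')"
  shows "csec A p l z = csec A p l' z"
proof -
  obtain z0 where "z0 \<in> bx 0 (hd l) \<inter> bx 0 (hd l')" "csec A p l z0 = csec A p l' z0"
    using assms(4) unfolding meets_def by blast
  then show ?thesis
    using sec_unique_Int[OF assms(1) _ _ chains_sec[OF assms(2)] chains_sec[OF assms(3)]] assms(5,6) by simp
qed

text \<open>All tails of a chain belong to the same level, so the continuation never leaves the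
  region. This allows chains to be pushed along maps defined on the region only.\<close>

lemma chain_region:
  assumes "etale A p"
  shows "l \<in> level_chains A p k \<Longrightarrow> chain (region A p k) p 0 l (csec A p l)"
proof (induction l rule: induct_list012)
  have sec: "sec (region A p k) p (bx 0 (hd l)) (csec A p l)" if "l \<in> level_chains A p k" for l
    using chains_sec[OF that] that unfolding sec_def region_def by auto
  {
    case 1
    then show ?case using chains_csec by fastforce
  next
    case (2 b)
    then show ?case using sec[OF 2] chains_csec[OF 2] by simp
  next
    case (3 b b' l)
    obtain s z where s: "chain A p 0 (b' # l) s" "z \<in> bx 0 b \<inter> bx 0 b'" "csec A p (b # b' # l) z = s z"
      using chains_csec[OF 3(3)] by auto
    then have "csec A p (b' # l) z = s z" using csec_eq[OF assms s(1)] by simp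
    moreover have "sec (region A p k) p (bx 0 b) (csec A p (b # b' # l))" using sec[OF 3(3)] by simp
    ultimately show ?case
      unfolding chain.simps using s(2,3) 3(2)[OF chains_tl[OF 3(3)]] by metis
  }
qed

text \<open>The sheets of the successive tails form a connected string from the basepoint to the
  last sheet.\<close>

lemma chains_start:
  assumes E: "etale A p" and "l \<in> level_chains A p k"
  shows "\<exists>C. connected C \<and> 0 \<in> C \<and> csec A p l ` bx 0 (hd l) \<subseteq> C \<and> C \<subseteq> region A p k"
  using assms(2)
proof (induction l rule: induct_list012)
  have img: "connected (csec A p l ` bx 0 (hd l))" "csec A p l ` bx 0 (hd l) \<subseteq> region A p k"
    if "l \<in> level_chains A p k" for l
    using chains_sec[OF that] that connected_continuous_image[OF _ convex_connected[OF convex_bx], of 0 "hd l"]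
    unfolding sec_def region_def by auto
  {
    case 1
    then show ?case using chains_csec by fastforce
  next
    case (2 b)
    have "0 \<in> bx 0 b" "csec A p [b] 0 = 0"
      using chains_csec[OF 2] by auto
    then have "0 \<in> csec A p [b] ` bx 0 b" by (metis image_eqI)
    then show ?case using img[OF 2] by (intro exI[of _ "csec A p [b] ` bx 0 b"]) auto
  next
    case (3 b b' l)
    obtain C where C: "connected C" "0 \<in> C" "csec A p (b' # l) ` bx 0 b' \<subseteq> C" "C \<subseteq> region A p k"
      using 3(2)[OF chains_tl[OF 3(3)]] by auto
    let ?D = "csec A p (b # b' # l) ` bx 0 b"
    obtain s z where s: "chain A p 0 (b' # l) s" "z \<in> bx 0 b \<inter> bx 0 b'" "csec A p (b # b' # l) z = s z"
      using chains_csec[OF 3(3)] by auto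
    then have "csec A p (b' # l) z = s z" using csec_eq[OF E s(1)] by simp
    then have "s z \<in> C \<inter> ?D"
      using C(3) s(2,3) by (metis IntE IntI image_eqI image_subset_iff)
    then have "connected (C \<union> ?D)"
      using connected_Un[OF C(1)] img(1)[OF 3(3)] by auto
    then show ?case using C img(2)[OF 3(3)] by (intro exI[of _ "C \<union> ?D"]) auto
  }
qed

lemma connected_region:
  assumes "etale A p" shows "connected (region A p k)"
proof (cases "level_chains A p k = {}")
  case True
  then show ?thesis unfolding region_def by simp
next
  case False
  have "connected_component (region A p k) 0 x" if "x \<in> region A p k" for x
  proof -
    obtain l where l: "l \<in> level_chains A p k" "x \<in> csec A p l ` bx 0 (hd l)"
      using \<open>x \<in> region A p k\<close> unfolding region_def by blast
    show ?thesis
      using chains_start[OF assms l(1)] l(2) unfolding connected_component_def by blast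
  qed
  then show ?thesis
    unfolding connected_iff_connected_component
    by (meson connected_component_sym connected_component_trans)
qed

text \<open>The box at which a chain starts is by itself a chain. It serves to check that glued maps
  fix the basepoint.\<close>

lemma chains_singleton:
  assumes "0 \<in> region A p k"
  obtains b where "[b] \<in> level_chains A p k" "0 \<in> bx 0 b" "csec A p [b] 0 = 0"
proof -
  have "\<exists>b. [b] \<in> level_chains A p k" if "l \<in> level_chains A p k" for l
    using that
  proof (induction l rule: induct_list012)
    case 1
    then show ?case using chains_csec by fastforce
  next
    case (2 b)
    then show ?case by blast
  next
    case (3 b b' l)
    then show ?case using chains_tl by blast
  qed
  then obtain b where b: "[b] \<in> level_chains A p k" using assms unfolding region_def by blast
  then show ?thesis using that chains_csec[OF b] by simp
qed

section \<open>Chains, regions and meetings under immersions\<close>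

lemma chains_push:
  assumes "immersion A p A' p' \<iota>" shows "level_chains A p k \<subseteq> level_chains A' p' k"
  unfolding level_chains_def using chain_push[OF assms, of "1 / (real k + 1)"] by fastforce

lemma csec_push:
  assumes "immersion A p A' p' \<iota>" "etale A' p'" "chain A p 0 l s" "z \<in> bx 0 (hd l)"
  shows "csec A' p' l z = \<iota> (csec A p l z)"
  using csec_eq[OF assms(2) chain_push[OF assms(1) order_refl chain_csec[OF assms(3) order_refl]]] assms(4)
  by simp

lemma region_push:
  assumes "immersion A p A' p' \<iota>" "etale A' p'"
  shows "\<iota> ` region A p k \<subseteq> region A' p' k"
proof
  fix y assume "y \<in> \<iota> ` region A p k"
  then obtain l z where l: "l \<in> level_chains A p k" "z \<in> bx 0 (hd l)" "y = \<iota> (csec A p l z)"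
    unfolding region_def by blast
  then have "y = csec A' p' l z" using csec_push[OF assms chains_csec[OF l(1)] l(2)] by simp
  then show "y \<in> region A' p' k"
    using l chains_push[OF assms(1)] unfolding region_def by blast
qed

lemma meets_push:
  assumes "immersion A p A' p' \<iota>" "etale A' p'" "l \<in> level_chains A p k" "l' \<in> level_chains A p k'" "meets A p l l'"
  shows "meets A' p' l l'"
  using assms(5) csec_push[OF assms(1,2) chains_csec[OF assms(3)]] csec_push[OF assms(1,2) chains_csec[OF assms(4)]]
  unfolding meets_def by force

text \<open>An immersion can create meetings of sheets but never destroys any; injectivity excludes
  new ones. This is how patterns distinguish embeddings from immersions.\<close>

lemma meets_push_inj:
  assumes "immersion A p A' p' \<iota>" "etale A' p'" "l \<in> level_chains A p k" "l' \<in> level_chains A p k'" "meets A' p' l l'"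
    and "inj_on \<iota> A"
  shows "meets A p l l'"
proof -
  obtain z where z: "z \<in> bx 0 (hd l) \<inter> bx 0 (hd l')" "csec A' p' l z = csec A' p' l' z"
    using assms(5) unfolding meets_def by blast
  then have "\<iota> (csec A p l z) = \<iota> (csec A p l' z)"
    using csec_push[OF assms(1,2) chains_csec[OF assms(3)]] csec_push[OF assms(1,2) chains_csec[OF assms(4)]] by force
  moreover have "csec A p l z \<in> A" "csec A p l' z \<in> A"
    using z(1) chains_sec[OF assms(3)] chains_sec[OF assms(4)] unfolding sec_def by auto
  ultimately show ?thesis using assms(6) z(1) unfolding meets_def by (metis inj_onD)
qed

text \<open>A region is its sheets glued along their meetings, and both surfaces have the same
  gluing data. Meetings carried forward make the map well defined, meetings carried back make it
  injective.\<close>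

lemma pattern_embedding:
  assumes E: "etale A p" "etale A' p'" and pat: "pattern A p k = pattern A' p' k" and 0: "0 \<in> region A p k"
  obtains \<iota> where "immersion (region A p k) p (region A' p' k) p' \<iota>" "inj_on \<iota> (region A p k)"
proof -
  let ?I = "level_chains A p k" and ?B = "\<lambda>l. bx 0 (hd l)"
  have I: "level_chains A' p' k = ?I" using pat unfolding pattern_def by simp
  have meets: "meets A p l l' \<longleftrightarrow> meets A' p' l l'" if "l \<in> ?I" "l' \<in> ?I" for l l'
    using pat that unfolding pattern_def I by auto
  have sA: "sec A p (?B l) (csec A p l)" if "l \<in> ?I" for l using chains_sec[OF that] .
  have sA': "sec A' p' (?B l) (csec A' p' l)" if "l \<in> ?I" for l using chains_sec that I by blast
  have sR': "sec (region A' p' k) p' (?B l) (csec A' p' l)" if "l \<in> ?I" for l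
    using sA'[OF that] that I unfolding region_def sec_def by auto
  have agree: "csec A' p' l z = csec A' p' l' z \<longleftrightarrow> csec A p l z = csec A p l' z"
    if "l \<in> ?I" "l' \<in> ?I" "z \<in> ?B l" "z \<in> ?B l'" for l l' z
    using meets[OF that(1,2)] meets_agree[OF E(1) that(1,2) _ that(3,4)] that
      meets_agree[OF E(2), of l k l' k z] I unfolding meets_def by blast
  obtain \<iota> where \<iota>: "continuous_on (region A p k) \<iota>" "\<iota> ` region A p k \<subseteq> region A' p' k"
    "\<And>x. x \<in> region A p k \<Longrightarrow> p' (\<iota> x) = p x"
    and \<iota>v: "\<And>l z. l \<in> ?I \<Longrightarrow> z \<in> ?B l \<Longrightarrow> \<iota> (csec A p l z) = csec A' p' l z"
    using glue_immersion[where I = ?I and B = ?B and s = "csec A p" and s' = "csec A' p'" and A = A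
        and A' = "region A' p' k" and p = p and p' = p'] sA sR' agree
    unfolding region_def[of A p] by (smt (verit, best) open_bx)
  obtain b where b: "[b] \<in> ?I" "0 \<in> bx 0 b" "csec A p [b] 0 = 0"
    using chains_singleton[OF 0] .
  have "csec A' p' [b] 0 = 0"
    using chains_csec[of "[b]" A' p' k] b I by simp
  then have "\<iota> 0 = 0" using \<iota>v[OF b(1), of 0] b by simp
  moreover have "inj_on \<iota> (region A p k)"
  proof (rule inj_onI)
    fix x y assume xy: "x \<in> region A p k" "y \<in> region A p k" "\<iota> x = \<iota> y"
    obtain l z where l: "l \<in> ?I" "z \<in> ?B l" "x = csec A p l z" using xy(1) unfolding region_def by blast
    obtain l' z' where l': "l' \<in> ?I" "z' \<in> ?B l'" "y = csec A p l' z'" using xy(2) unfolding region_def by blast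
    have "p x = p y" using \<iota>(3) xy by metis
    then have "z = z'" using l l' sA unfolding sec_def by metis
    then show "x = y" using agree[OF l(1) l'(1)] l l' \<iota>v xy(3) by metis
  qed
  ultimately show ?thesis using that \<iota> unfolding immersion_def by blast
qed

text \<open>Appending a box costs one entry of length, a larger index and some slack, and
  \<open>k'\<close> pays for all three. Both the exhaustion of a surface and the filling of holes
  enlarge regions this way.\<close>

lemma region_extend:
  assumes E: "etale A p" and l: "l \<in> level_chains A p k" and t: "sec A p (bx h b) t" and h: "h > 0"
    and z: "z \<in> bx 0 b" "z \<in> bx 0 (hd l)" "t z = csec A p l z"
    and k': "k < k'" "b \<in> from_nat ` {..<k'}" "1 / (real k' + 1) \<le> h"
  shows "t ` bx 0 b \<subseteq> region A p k'"
proof -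
  let ?\<eta> = "1 / (real k' + 1)"
  have \<eta>0: "0 \<le> ?\<eta>" by simp
  have l': "l \<in> level_chains A p k'" using l k' chains_mono[of k k'] by auto
  then obtain s where s: "chain A p ?\<eta> l s" unfolding level_chains_def by blast
  have sz: "t z = s z" using csec_eq[OF E s \<eta>0 z(2)] z(3) by simp
  have t': "sec A p (bx ?\<eta> b) t" using sec_subset[OF t bx_mono[OF k'(3)]] .
  have ch: "chain A p ?\<eta> (b # l) t" using chain_extend[OF s t' z(1,2) sz] .
  moreover have "length (b # l) \<le> k'" using l k' unfolding level_chains_def by auto
  moreover have "set (b # l) \<subseteq> from_nat ` {..<k'}" using l' k' unfolding level_chains_def by auto
  ultimately have bl: "b # l \<in> level_chains A p k'" unfolding level_chains_def by blast
  have "csec A p (b # l) z = t z" if "z \<in> bx 0 b" for z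
    using csec_eq[OF E ch \<eta>0] that by simp
  then show ?thesis using bl unfolding region_def by force
qed

lemma ex_index:
  fixes h :: real
  assumes "finite (G :: box_data set)" "h > 0"
  obtains k' where "k < k'" "G \<subseteq> from_nat ` {..<k'}" "1 / (real k' + 1) \<le> h"
proof -
  obtain m where m: "1 / h < real m" using reals_Archimedean2 by blast
  define k' where "k' = Suc (k + m + Max (insert 0 (to_nat ` G)))"
  have "b \<in> from_nat ` {..<k'}" if "b \<in> G" for b
  proof -
    have "to_nat b \<le> Max (insert 0 (to_nat ` G))" using assms(1) that by (intro Max_ge) auto
    then have "to_nat b < k'" unfolding k'_def by simp
    then show ?thesis by (metis from_nat_to_nat image_eqI lessThan_iff)
  qed
  moreover have "1 / (real k' + 1) \<le> h"
  proof -
    have "1 / h \<le> real k' + 1" using m unfolding k'_def by simp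
    then have "1 \<le> (real k' + 1) * h" using assms(2) by (simp add: pos_divide_le_eq)
    then show ?thesis by (simp add: pos_divide_le_eq mult.commute)
  qed
  moreover have "k < k'" unfolding k'_def by simp
  ultimately show ?thesis using that by blast
qed

lemma local_box_section:
  assumes "etale A p" "x \<in> A"
  obtains h b t where "h > 0" "sec A p (bx h b) t" "p x \<in> bx 0 b" "t (p x) = x"
proof -
  obtain e t where t: "e > 0" "sec A p (ball (p x) e) t" "t (p x) = x"
    using local_section[OF assms] .
  have e: "e / 2 > 0" using t by simp
  obtain h where h: "h > 0" and G: "\<And>M. \<exists>G. finite G \<and> (\<forall>w T. 0 \<le> T \<longrightarrow> \<bar>Re w\<bar> \<le> M \<longrightarrow> \<bar>Im w\<bar> \<le> M \<longrightarrow> Re w + T \<le> M \<longrightarrow>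
       (\<exists>b\<in>G. (\<forall>t\<in>{0..T}. w + of_real t \<in> bx 0 b) \<and> bx h b \<subseteq> rect w T (e / 2)))"
    by (rule round_to_box[OF e]) blast
  let ?M = "\<bar>Re (p x)\<bar> + \<bar>Im (p x)\<bar>"
  obtain G' where G': "\<And>w T. 0 \<le> T \<Longrightarrow> \<bar>Re w\<bar> \<le> ?M \<Longrightarrow> \<bar>Im w\<bar> \<le> ?M \<Longrightarrow> Re w + T \<le> ?M \<Longrightarrow>
       \<exists>b\<in>G'. (\<forall>t\<in>{0..T}. w + of_real t \<in> bx 0 b) \<and> bx h b \<subseteq> rect w T (e / 2)"
    using G[of ?M] by metis
  have "\<exists>b\<in>G'. (\<forall>t\<in>{0..0}. p x + of_real t \<in> bx 0 b) \<and> bx h b \<subseteq> rect (p x) 0 (e / 2)"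
    by (rule G') auto
  then obtain b where b: "p x \<in> bx 0 b" "bx h b \<subseteq> rect (p x) 0 (e / 2)" by auto
  then have "sec A p (bx h b) t" using t(2) rect_subset_ball sec_subset by blast
  then show ?thesis using that h b t by blast
qed

text \<open>The union of the regions is open, and so is its complement in \<open>A\<close>: a box
  sheet around \<open>x\<close> that meets some region can be appended to a chain, which puts
  \<open>x\<close> in a later region.\<close>

lemma region_exhausts:
  assumes E: "etale A p" and A: "connected A" "0 \<in> A" "p 0 = 0"
  shows "(\<Union>k. region A p k) = A"
proof -
  let ?R = "\<Union>k. region A p k"
  have ext: "\<exists>U. open U \<and> x \<in> U \<and> U \<subseteq> A \<and> (U \<inter> ?R \<noteq> {} \<longrightarrow> x \<in> ?R)" if x: "x \<in> A" for x
  proof -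
    obtain h b t where t: "h > 0" "sec A p (bx h b) t" "p x \<in> bx 0 b" "t (p x) = x"
      using local_box_section[OF E x] .
    have s0: "sec A p (bx 0 b) t" using sec_subset[OF t(2) bx_mono] t(1) by simp
    have "x \<in> ?R" if ne: "t ` bx 0 b \<inter> ?R \<noteq> {}"
    proof -
      obtain k l z w where l: "l \<in> level_chains A p k" "z \<in> bx 0 (hd l)" "w \<in> bx 0 b" "t w = csec A p l z"
        using ne unfolding region_def by blast
      have "w = z" using l chains_sec[OF l(1)] s0 unfolding sec_def by metis
      obtain k' where k': "k < k'" "{b} \<subseteq> from_nat ` {..<k'}" "1 / (real k' + 1) \<le> h"
        using ex_index[of "{b}" h] t(1) by auto
      have "t ` bx 0 b \<subseteq> region A p k'"
        using region_extend[OF E l(1) t(2,1) l(3)] l \<open>w = z\<close> k' by simp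
      then show ?thesis using t by (metis UN_I UNIV_I image_subset_iff)
    qed
    moreover have "open (t ` bx 0 b)" "x \<in> t ` bx 0 b" "t ` bx 0 b \<subseteq> A"
      using sec_open[OF s0] t s0 unfolding sec_def by (auto simp: image_iff intro!: bexI[of _ "p x"])
    ultimately show ?thesis by blast
  qed
  have "0 \<in> ?R"
  proof -
    obtain h b t where t: "h > 0" "sec A p (bx h b) t" "p 0 \<in> bx 0 b" "t (p 0) = 0"
      using local_box_section[OF E A(2)] .
    obtain k' where k': "0 < k'" "{b} \<subseteq> from_nat ` {..<k'}" "1 / (real k' + 1) \<le> h"
      using ex_index[of "{b}" h] t(1) by auto
    have ch: "chain A p (1 / (real k' + 1)) [b] t"
      using t A sec_subset[OF t(2) bx_mono[OF k'(3)]] by simp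
    then have "[b] \<in> level_chains A p k'" using k' unfolding level_chains_def by auto
    moreover have "csec A p [b] 0 = 0" using csec_eq[OF E ch, of 0] t A by simp
    moreover have "0 \<in> bx 0 b" using t A by simp
    ultimately have "0 \<in> region A p k'" unfolding region_def by (force simp: image_iff)
    then show ?thesis by blast
  qed
  moreover have "open ?R" by auto
  moreover have "open (A - ?R)"
  proof (subst open_subopen, clarify)
    fix x assume x: "x \<in> A" "x \<notin> ?R"
    show "\<exists>T. open T \<and> x \<in> T \<and> T \<subseteq> A - ?R"
    proof -
      obtain U where "open U" "x \<in> U" "U \<subseteq> A" "U \<inter> ?R \<noteq> {} \<longrightarrow> x \<in> ?R" using ext[OF x(1)] by metis
      then show ?thesis using x(2) by (intro exI[of _ U]) auto
    qed
  qed
  moreover have "?R \<subseteq> A" using region_subset by blast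
  ultimately have "?R \<inter> A = {} \<or> (A - ?R) \<inter> A = {}"
    by (intro connectedD[OF A(1)]) auto
  then show ?thesis using \<open>0 \<in> ?R\<close> \<open>?R \<subseteq> A\<close> A(2) by blast
qed

section \<open>Filling in a region\<close>

text \<open>A lower bound \<open>\<rho>\<close> for the distance from \<open>x\<close> to the ideal
  boundary, measured in the plane by the maximum norm.\<close>

definition thick :: "complex set \<Rightarrow> (complex \<Rightarrow> complex) \<Rightarrow> real \<Rightarrow> complex \<Rightarrow> bool" where
  "thick A p \<rho> x \<longleftrightarrow> (\<exists>s. sec A p (rect (p x) 0 \<rho>) s \<and> s (p x) = x)"

lemma thick_mono: "thick A p \<rho> x \<Longrightarrow> \<rho>' \<le> \<rho> \<Longrightarrow> thick A p \<rho>' x"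
proof -
  assume a: "thick A p \<rho> x" "\<rho>' \<le> \<rho>"
  have "rect (p x) 0 \<rho>' \<subseteq> rect (p x) 0 \<rho>" using a(2) unfolding rect_def by auto
  then show ?thesis using a(1) sec_subset unfolding thick_def by blast
qed

lemma mem_rect0: "z \<in> rect w 0 \<rho> \<longleftrightarrow> \<bar>Re z - Re w\<bar> < \<rho> \<and> \<bar>Im z - Im w\<bar> < \<rho>"
  unfolding rect_def by auto

lemma compact_thick:
  assumes E: "etale A p" and H: "compact H" "H \<subseteq> A"
  obtains \<rho> where "\<rho> > 0" "\<And>x. x \<in> H \<Longrightarrow> thick A p \<rho> x"
proof -
  have "\<exists>N e. open N \<and> x \<in> N \<and> e > 0 \<and> (\<forall>y\<in>N. thick A p e y)" if x: "x \<in> H" for x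
  proof -
    obtain e s where s: "e > 0" "sec A p (ball (p x) e) s" "s (p x) = x"
      using local_section[OF E] x H by blast
    \<comment> \<open>A square of radius \<open>r\<close> about a point at distance below
      \<open>r\<close> lies in the square of radius \<open>2 * r = e / 2\<close>, and that one in
      the Euclidean ball of radius \<open>e\<close>.\<close>
    define r where "r = e / 4"
    have r: "r > 0" using s unfolding r_def by simp
    have sub: "rect (p x) 0 (2 * r) \<subseteq> ball (p x) e"
      using rect_subset_ball[of "p x" e] unfolding r_def by simp
    have small: "rect (p x) 0 r \<subseteq> rect (p x) 0 (2 * r)" using r unfolding rect_def by auto
    have sr: "sec A p (rect (p x) 0 r) s" using sec_subset[OF s(2)] sub small by blast
    have "thick A p r y" if y: "y \<in> s ` rect (p x) 0 r" for y
    proof -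
      obtain z where z: "z \<in> rect (p x) 0 r" "y = s z" using y by blast
      then have pz: "p y = z" using sr unfolding sec_def by blast
      have "rect z 0 r \<subseteq> rect (p x) 0 (2 * r)" using z(1) unfolding rect_def by auto
      then have "sec A p (rect (p y) 0 r) s" using sec_subset[OF s(2)] sub pz by blast
      then show ?thesis using z(2) pz unfolding thick_def by metis
    qed
    moreover have "x \<in> s ` rect (p x) 0 r"
      using s r by (intro image_eqI[of _ _ "p x"]) (auto simp: mem_rect0)
    ultimately show ?thesis using sec_open[OF sr] r by (intro exI[of _ "s ` rect (p x) 0 r"] exI[of _ r]) simp
  qed
  then obtain N e where N: "\<And>x. x \<in> H \<Longrightarrow> open (N x)" "\<And>x. x \<in> H \<Longrightarrow> x \<in> N x"
    "\<And>x. x \<in> H \<Longrightarrow> e x > (0::real)" "\<And>x y. x \<in> H \<Longrightarrow> y \<in> N x \<Longrightarrow> thick A p (e x) y"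
    by metis
  obtain C where C: "C \<subseteq> H" "finite C" "H \<subseteq> (\<Union>c\<in>C. N c)"
    using compactE_image[OF H(1), of H N] N by blast
  define \<rho> where "\<rho> = Min (insert 1 (e ` C))"
  have "\<rho> > 0" using C N unfolding \<rho>_def by (subst Min_gr_iff) auto
  moreover have "thick A p \<rho> x" if x: "x \<in> H" for x
  proof -
    obtain c where c: "c \<in> C" "x \<in> N c" using C x by blast
    have "\<rho> \<le> e c" unfolding \<rho>_def using C c by (intro Min_le) auto
    then show ?thesis using thick_mono N(4) c C by blast
  qed
  ultimately show ?thesis using that by blast
qed

lemma exit_through_frontier:
  fixes s :: "complex \<Rightarrow> complex"
  assumes "continuous_on B s" "closed_segment u v \<subseteq> B" "s u \<in> H" "s v \<notin> H" "frontier H \<subseteq> L"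
  obtains z where "z \<in> closed_segment u v" "s z \<in> L"
proof -
  let ?S = "s ` closed_segment u v"
  have "connected ?S"
    using assms(1,2) continuous_on_subset by (blast intro: connected_continuous_image connected_segment)
  moreover have "s u \<in> ?S" "s v \<in> ?S" by auto
  ultimately have "?S \<inter> frontier H \<noteq> {}"
    using assms by (intro connected_Int_frontier) blast+
  then show ?thesis using that assms(5) by blast
qed

text \<open>Minimum principle for the distance to the ideal boundary: a point of the compact set \<open>H\<close> from which
  one can move in some direction only by crossing \<open>L\<close> inherits the thickness of \<open>L\<close>; otherwise the
  sections around all nearby points glue to a larger one.\<close>
lemma thicken_step:
  assumes E: "etale A p" and fr: "frontier H \<subseteq> L" and L: "\<And>x. x \<in> L \<Longrightarrow> thick A p \<eta> x"
    and \<rho>: "0 < \<rho>" "\<rho> < \<eta>" and H: "\<And>x. x \<in> H \<Longrightarrow> thick A p \<rho> x"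
    and \<delta>: "\<delta> = min \<rho> ((\<eta> - \<rho>) / 2)" and x: "x \<in> H"
  shows "thick A p (\<rho> + \<delta>) x"
proof -
  \<comment> \<open>\<open>\<delta> \<le> \<rho>\<close> keeps the squares of nearby points
    overlapping; \<open>\<rho> + 2 * \<delta> \<le> \<eta>\<close> lets a square of radius
    \<open>\<eta>\<close> centred within \<open>\<delta>\<close> of \<open>p x\<close> contain the
    wanted one.\<close>
  have \<delta>0: "0 < \<delta>" "\<delta> \<le> \<rho>" "\<rho> + \<delta> \<le> \<eta> - \<delta>" using \<rho> unfolding \<delta> by (auto simp: min_def field_simps)
  obtain s where s: "sec A p (rect (p x) 0 \<rho>) s" "s (p x) = x"
    using H[OF x] unfolding thick_def by blast
  have sub: "rect (p x) 0 \<delta> \<subseteq> rect (p x) 0 \<rho>" using \<delta>0 unfolding rect_def by auto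
  have px: "p x \<in> rect (p x) 0 \<delta>" using \<delta>0 by (simp add: mem_rect0)
  show ?thesis
  proof (cases "\<exists>z\<in>rect (p x) 0 \<delta>. s z \<notin> H")
    case True
    then obtain v where v: "v \<in> rect (p x) 0 \<delta>" "s v \<notin> H" by blast
    have seg: "closed_segment (p x) v \<subseteq> rect (p x) 0 \<delta>"
      using px v by (intro closed_segment_subset) auto
    have "closed_segment (p x) v \<subseteq> rect (p x) 0 \<rho>" using seg sub by blast
    then obtain z where z: "z \<in> closed_segment (p x) v" "s z \<in> L"
      using exit_through_frontier[of "rect (p x) 0 \<rho>" s "p x" v H L] s v x fr unfolding sec_def by metis
    have zr: "z \<in> rect (p x) 0 \<delta>" using z seg by blast
    have pz: "p (s z) = z" using zr sub s unfolding sec_def by blast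
    obtain t where t: "sec A p (rect z 0 \<eta>) t" "t z = s z"
      using L[OF z(2)] pz unfolding thick_def by metis
    have "t (p x) = s (p x)"
    proof (rule sec_unique_Int[OF E _ _ t(1) s(1), of z])
      show "z \<in> rect z 0 \<eta> \<inter> rect (p x) 0 \<rho>" using zr sub \<rho> by (auto simp: mem_rect0)
      show "p x \<in> rect z 0 \<eta> \<inter> rect (p x) 0 \<rho>" using zr \<delta>0 \<rho> by (auto simp: mem_rect0)
    qed (use t in auto)
    moreover have "rect (p x) 0 (\<rho> + \<delta>) \<subseteq> rect z 0 \<eta>"
    proof
      fix u assume "u \<in> rect (p x) 0 (\<rho> + \<delta>)"
      then show "u \<in> rect z 0 \<eta>" using zr \<delta>0 unfolding mem_rect0 by linarith
    qed
    ultimately show ?thesis using sec_subset[OF t(1)] s(2) unfolding thick_def by metis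
  next
    case False
    have "\<exists>t. sec A p (rect z 0 \<rho>) t \<and> t z = s z" if z: "z \<in> rect (p x) 0 \<delta>" for z
    proof -
      have "p (s z) = z" using z sub s unfolding sec_def by blast
      then show ?thesis using H[of "s z"] False z unfolding thick_def by metis
    qed
    then obtain t where t: "\<And>z. z \<in> rect (p x) 0 \<delta> \<Longrightarrow> sec A p (rect z 0 \<rho>) (t z)"
      "\<And>z. z \<in> rect (p x) 0 \<delta> \<Longrightarrow> t z z = s z" by metis
    have ts: "t z u = s u" if "z \<in> rect (p x) 0 \<delta>" "u \<in> rect z 0 \<rho>" "u \<in> rect (p x) 0 \<rho>" for z u
    proof (rule sec_unique_Int[OF E _ _ t(1)[OF that(1)] s(1), of z])
      show "z \<in> rect z 0 \<rho> \<inter> rect (p x) 0 \<rho>" using that sub \<rho> by (auto simp: mem_rect0)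
    qed (use that t in auto)
    have "t z u = t z' u" if z: "z \<in> rect (p x) 0 \<delta>" "z' \<in> rect (p x) 0 \<delta>"
        and u: "u \<in> rect z 0 \<rho>" "u \<in> rect z' 0 \<rho>" for z z' u
    proof -
      \<comment> \<open>The midpoint of the two centres lies in both squares and in the domain of
        \<open>s\<close>; there both branches equal \<open>s\<close>, so they agree on the
        overlap.\<close>
      define m where "m = (z + z') / 2"
      have mr: "Re m = (Re z + Re z') / 2" "Im m = (Im z + Im z') / 2" unfolding m_def by auto
      have m: "m \<in> rect z 0 \<rho>" "m \<in> rect z' 0 \<rho>" "m \<in> rect (p x) 0 \<rho>"
        using z \<delta>0 unfolding mem_rect0 mr by (auto simp: abs_less_iff field_simps)
      show ?thesis
        by (rule sec_unique_Int[OF E _ _ t(1)[OF z(1)] t(1)[OF z(2)], of m])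
           (use m u ts z in auto)
    qed
    then obtain t' where t': "sec A p (\<Union>z\<in>rect (p x) 0 \<delta>. rect z 0 \<rho>) t'"
      "\<And>z u. z \<in> rect (p x) 0 \<delta> \<Longrightarrow> u \<in> rect z 0 \<rho> \<Longrightarrow> t' u = t z u"
      using sec_glue[of "rect (p x) 0 \<delta>" "\<lambda>z. rect z 0 \<rho>" A p t] t(1) open_rect by (metis (no_types, lifting))
    have "rect (p x) 0 (\<rho> + \<delta>) \<subseteq> (\<Union>z\<in>rect (p x) 0 \<delta>. rect z 0 \<rho>)"
    proof
      fix u assume u: "u \<in> rect (p x) 0 (\<rho> + \<delta>)"
      \<comment> \<open>\<open>z\<close> divides the segment from \<open>p x\<close> to
        \<open>u\<close> in the ratio \<open>\<delta>\<close> to \<open>\<rho>\<close>, so it is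
        within \<open>\<delta>\<close> of \<open>p x\<close> and within \<open>\<rho>\<close> of
        \<open>u\<close>.\<close>
      define c where "c = \<delta> / (\<rho> + \<delta>)"
      have c: "0 < c" "c * (\<rho> + \<delta>) = \<delta>" "0 < 1 - c" "(1 - c) * (\<rho> + \<delta>) = \<rho>"
        using \<rho> \<delta>0 unfolding c_def by (auto simp: field_simps)
      define z where "z = p x + of_real c * (u - p x)"
      have small: "\<bar>c * d\<bar> < \<delta>" "\<bar>d - c * d\<bar> < \<rho>" if "\<bar>d\<bar> < \<rho> + \<delta>" for d
      proof -
        have "\<bar>c * d\<bar> = c * \<bar>d\<bar>" using c by (simp add: abs_mult)
        then show "\<bar>c * d\<bar> < \<delta>" using mult_strict_left_mono[OF that c(1)] c by simp
        have "\<bar>d - c * d\<bar> = \<bar>(1 - c) * d\<bar>" by (simp add: left_diff_distrib)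
        also have "\<dots> = (1 - c) * \<bar>d\<bar>" using c(3) by (simp add: abs_mult)
        finally show "\<bar>d - c * d\<bar> < \<rho>" using mult_strict_left_mono[OF that c(3)] c by simp
      qed
      have zr: "Re z = Re (p x) + c * (Re u - Re (p x))" "Im z = Im (p x) + c * (Im u - Im (p x))"
        unfolding z_def by auto
      have "z \<in> rect (p x) 0 \<delta>" using small(1) u unfolding mem_rect0 zr by simp
      moreover have "u \<in> rect z 0 \<rho>"
        using small(2)[of "Re u - Re (p x)"] small(2)[of "Im u - Im (p x)"] u
        unfolding mem_rect0 zr by (simp add: algebra_simps)
      ultimately show "u \<in> (\<Union>z\<in>rect (p x) 0 \<delta>. rect z 0 \<rho>)" by blast
    qed
    then have "sec A p (rect (p x) 0 (\<rho> + \<delta>)) t'" using sec_subset[OF t'(1)] by blast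
    moreover have "t' (p x) = x"
      using t'(2)[OF px, of "p x"] t(2)[OF px] s(2) \<rho> by (simp add: mem_rect0)
    ultimately show ?thesis unfolding thick_def by blast
  qed
qed

text \<open>Compactness makes the uniform thickness of \<open>H\<close> positive. As long as it
  stays below \<open>\<eta> / 2\<close>, the thickening step carries a radius close enough to the
  supremum beyond it.\<close>

lemma thick_inside:
  assumes E: "etale A p" and H: "compact H" "H \<subseteq> A" and fr: "frontier H \<subseteq> L"
    and L: "\<And>x. x \<in> L \<Longrightarrow> thick A p \<eta> x" and \<eta>: "\<eta> > 0" and x: "x \<in> H"
  shows "thick A p (\<eta> / 2) x"
proof (rule ccontr)
  assume neg: "\<not> thick A p (\<eta> / 2) x"
  let ?P = "{\<rho>. 0 < \<rho> \<and> (\<forall>y\<in>H. thick A p \<rho> y)}"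
  obtain \<rho>0 where \<rho>0: "\<rho>0 \<in> ?P" by (rule compact_thick[OF E H]) auto
  have up: "\<rho> < \<eta> / 2" if "\<rho> \<in> ?P" for \<rho>
    using that neg x thick_mono[of A p \<rho> x "\<eta> / 2"] by (cases "\<eta> / 2 \<le> \<rho>") auto
  have bdd: "bdd_above ?P" using up by (meson bdd_above.I less_imp_le)
  define \<sigma> where "\<sigma> = Sup ?P"
  have "\<rho>0 \<le> \<sigma>" unfolding \<sigma>_def by (rule cSup_upper[OF \<rho>0 bdd])
  then have \<sigma>: "0 < \<sigma>" using \<rho>0 by auto
  \<comment> \<open>The margin is smaller than the gain \<open>\<delta>\<close>:
    \<open>\<rho> > \<sigma> / 2\<close> gives \<open>2 * \<rho> > \<sigma>\<close>, and
    \<open>\<rho> < \<eta> / 2\<close> gives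
    \<open>(\<eta> - \<rho>) / 2 > \<eta> / 4\<close>.\<close>
  have "\<sigma> - min (\<sigma> / 2) (\<eta> / 4) < \<sigma>" using \<sigma> \<eta> by simp
  then obtain \<rho> where \<rho>: "\<rho> \<in> ?P" "\<sigma> - min (\<sigma> / 2) (\<eta> / 4) < \<rho>"
    using less_cSup_iff[OF _ bdd] \<rho>0 unfolding \<sigma>_def by (metis (no_types, lifting) empty_iff)
  define \<delta> where "\<delta> = min \<rho> ((\<eta> - \<rho>) / 2)"
  have b: "\<rho> < \<eta> / 2" using up[OF \<rho>(1)] .
  have pos: "0 < \<rho>" using \<rho>(1) by blast
  have "thick A p (\<rho> + \<delta>) y" if "y \<in> H" for y
    by (rule thicken_step[OF E fr L _ _ _ \<delta>_def that]) (use \<rho> b \<eta> in auto)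
  moreover have "0 < (\<eta> - \<rho>) / 2" using pos b by simp
  then have "0 < \<rho> + \<delta>" using pos unfolding \<delta>_def by (intro add_pos_pos) auto
  ultimately have "\<rho> + \<delta> \<in> ?P" by blast
  then have "\<rho> + \<delta> \<le> \<sigma>" unfolding \<sigma>_def by (rule cSup_upper[OF _ bdd])
  moreover have "\<sigma> < \<rho> + \<delta>"
  proof -
    have "\<sigma> - \<sigma> / 2 < \<rho>" "\<sigma> - \<eta> / 4 < \<rho>" using \<rho>(2) by auto
    then have "\<sigma> < \<rho> + \<rho>" "\<sigma> < \<rho> + (\<eta> - \<rho>) / 2"
      using b \<eta> pos by (simp_all add: field_simps)
    then show ?thesis unfolding \<delta>_def min_def by simp
  qed
  ultimately show False by simp
qed

lemma extend_rect:
  assumes E: "etale A p" and t: "sec A p (rect w T \<rho>) t" and T: "0 \<le> T" "T \<le> T'" "T' < T + \<rho>"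
    and th: "thick A p \<rho> (t (w + of_real T'))"
  obtains t' where "sec A p (rect w T' \<rho>) t'" "t' w = t w" "t' (w + of_real T') = t (w + of_real T')"
proof -
  let ?v = "w + of_real T'"
  have \<rho>: "\<rho> > 0" using T by simp
  have vr: "?v \<in> rect w T \<rho>" using T \<rho> unfolding rect_def by auto
  then have pv: "p (t ?v) = ?v" using t unfolding sec_def by blast
  obtain s where s: "sec A p (rect ?v 0 \<rho>) s" "s ?v = t ?v"
    using th pv unfolding thick_def by metis
  have vs: "?v \<in> rect ?v 0 \<rho>" using \<rho> by (simp add: mem_rect0)
  have "t z = s z" if "z \<in> rect w T \<rho>" "z \<in> rect ?v 0 \<rho>" for z
    by (rule sec_unique_Int[OF E _ _ t s(1), of ?v]) (use vr vs s that in auto)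
  then obtain t' where t': "sec A p (rect w T \<rho> \<union> rect ?v 0 \<rho>) t'" "\<And>z. z \<in> rect w T \<rho> \<Longrightarrow> t' z = t z"
    using sec_glue2[OF open_rect open_rect t s(1)] by metis
  have "rect w T' \<rho> \<subseteq> rect w T \<rho> \<union> rect ?v 0 \<rho>" using T unfolding rect_def by auto
  moreover have "w \<in> rect w T \<rho>" using \<rho> T unfolding rect_def by auto
  ultimately show ?thesis using that[of t'] t' sec_subset vr by blast
qed

text \<open>Walk to the right in steps of \<open>\<rho> / 2\<close>. Inside \<open>H\<close> each
  step prolongs the branch, a step out of \<open>H\<close> crosses \<open>L\<close>, and the walk
  must leave \<open>H\<close> because \<open>p\<close> is bounded there.\<close>

lemma horizontal_rect:
  assumes E: "etale A p" and H: "compact H" "H \<subseteq> A" and fr: "frontier H \<subseteq> L" "L \<subseteq> H"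
    and \<rho>: "\<rho> > 0" and th: "\<And>x. x \<in> H \<Longrightarrow> thick A p \<rho> x" and x: "x \<in> H"
  obtains T t where "0 \<le> T" "sec A p (rect (p x) T \<rho>) t" "t (p x) = x" "t (p x + of_real T) \<in> L"
proof -
  let ?w = "p x"
  define good where "good = (\<exists>T t. 0 \<le> T \<and> sec A p (rect ?w T \<rho>) t \<and> t ?w = x \<and> t (?w + of_real T) \<in> L)"
  have claim: "good \<or> (\<exists>t. sec A p (rect ?w (real n * (\<rho> / 2)) \<rho>) t \<and> t ?w = x \<and> t (?w + of_real (real n * (\<rho> / 2))) \<in> H)" for n
  proof (induction n)
    case 0
    then show ?case using th[OF x] x unfolding thick_def by auto
  next
    case (Suc n)
    define T where "T = real n * (\<rho> / 2)"
    define T' where "T' = real (Suc n) * (\<rho> / 2)"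
    have T: "0 \<le> T" "T' = T + \<rho> / 2" using \<rho> unfolding T_def T'_def by (auto simp: field_simps)
    show ?case
    proof (cases good)
      case False
      then obtain t where t: "sec A p (rect ?w T \<rho>) t" "t ?w = x" "t (?w + of_real T) \<in> H"
        using Suc unfolding T_def by blast
      show ?thesis
      proof (cases "t (?w + of_real T') \<in> H")
        case True
        obtain t' where "sec A p (rect ?w T' \<rho>) t'" "t' ?w = t ?w" "t' (?w + of_real T') = t (?w + of_real T')"
          by (rule extend_rect[OF E t(1), of T']) (use T \<rho> th[OF True] in auto)
        then show ?thesis using t True unfolding T'_def[symmetric] by metis
      next
        case False
        have seg: "closed_segment (?w + of_real T) (?w + of_real T') \<subseteq> rect ?w T \<rho>"
          by (intro closed_segment_subset convex_rect) (use T \<rho> in \<open>auto simp: rect_def\<close>)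
        obtain z where z: "z \<in> closed_segment (?w + of_real T) (?w + of_real T')" "t z \<in> L"
          using exit_through_frontier[OF _ seg t(3) False fr(1)] t(1) unfolding sec_def by blast
        obtain u where u: "0 \<le> u" "u \<le> 1" "z = (1 - u) *\<^sub>R (?w + of_real T) + u *\<^sub>R (?w + of_real T')"
          using z(1) by (auto simp: in_segment)
        define S where "S = T + u * (\<rho> / 2)"
        have zS: "z = ?w + of_real S"
          unfolding u(3) S_def T(2) by (simp add: scaleR_conv_of_real algebra_simps)
        have S: "0 \<le> S" "T \<le> S" "S < T + \<rho>"
          using u \<rho> T mult_right_mono[of u 1 "\<rho> / 2"] unfolding S_def by auto
        obtain t' where "sec A p (rect ?w S \<rho>) t'" "t' ?w = t ?w" "t' (?w + of_real S) = t (?w + of_real S)"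
          by (rule extend_rect[OF E t(1), of S]) (use T S th z zS fr(2) in auto)
        then have good using S(1) t(2) z(2) zS unfolding good_def by metis
        then show ?thesis by blast
      qed
    qed blast
  qed
  have good
  proof (rule ccontr)
    assume ng: "\<not> good"
    have "continuous_on H p" using E H continuous_on_subset unfolding etale_def by blast
    then have "bounded (p ` H)" using H compact_continuous_image compact_imp_bounded by blast
    then obtain B where B: "\<And>y. y \<in> H \<Longrightarrow> norm (p y) \<le> B" unfolding bounded_iff by blast
    obtain n :: nat where n: "(B - Re ?w) / (\<rho> / 2) < real n" using reals_Archimedean2 by blast
    define T where "T = real n * (\<rho> / 2)"
    have "0 \<le> T" unfolding T_def using \<rho> by simp
    have "(B - Re ?w) < T" using n \<rho> unfolding T_def by (simp add: field_simps)
    obtain t where t: "sec A p (rect ?w T \<rho>) t" "t (?w + of_real T) \<in> H"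
      using claim[of n] ng unfolding T_def by blast
    have "?w + of_real T \<in> rect ?w T \<rho>" using \<rho> \<open>0 \<le> T\<close> unfolding rect_def by auto
    then have "p (t (?w + of_real T)) = ?w + of_real T" using t unfolding sec_def by blast
    then have "norm (?w + of_real T) \<le> B" using B[OF t(2)] by simp
    then have "Re ?w + T \<le> B" using complex_Re_le_cmod[of "?w + of_real T"] by simp
    then show False using \<open>B - Re ?w < T\<close> by simp
  qed
  then show ?thesis using that unfolding good_def by blast
qed

text \<open>Filling the holes leaves the complement of \<open>outside W\<close>, which is connected
  and unbounded. Removing a component of the complement of a connected set leaves a connected
  set.\<close>

lemma simply_connected_fill:
  fixes W :: "complex set"
  assumes "open W" "connected W" "bounded W"
  shows "open (W \<union> inside W)" "connected (W \<union> inside W)" "simply_connected (W \<union> inside W)"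
proof -
  have out: "connected (outside W)" "\<not> bounded (outside W)"
    using connected_outside[OF assms(3)] unbounded_outside[OF assms(3)] by auto
  then have "outside W \<noteq> {}" by auto
  then have comp: "outside W \<in> components (- W)" using out outside_in_components by blast
  then have "closed (outside W)" using closed_components[OF _ comp] assms(1) by (simp add: closed_Compl)
  then show o: "open (W \<union> inside W)" unfolding union_with_inside by (simp add: open_Compl)
  show c: "connected (W \<union> inside W)"
    unfolding union_with_inside using component_complement_connected[OF assms(2) comp] .
  have "inside (W \<union> inside W) = {}"
  proof -
    have "connected_component_set (outside W) x = outside W" if "x \<in> outside W" for x
      using out(1) that connected_component_eq_self by blast
    then show ?thesis
      using out(2) unfolding union_with_inside unfolding inside_def by auto
  qed
  then show "simply_connected (W \<union> inside W)"
    using simply_connected_eq_empty_inside[OF o] c by simp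
qed

text \<open>A region is a finite union of sheets, and the slack extends each section to the closed
  box. The images of the closed boxes are compact, so their union is closed.\<close>

lemma closure_region:
  assumes E: "etale A p" and x: "x \<in> closure (region A p k)"
  obtains l s z where "l \<in> level_chains A p k" "chain A p (1 / (real k + 1)) l s" "z \<in> closure (bx 0 (hd l))" "x = s z"
proof -
  have "level_chains A p k \<subseteq> {l. set l \<subseteq> from_nat ` {..<k} \<and> length l \<le> k}" unfolding level_chains_def by auto
  then have fin: "finite (level_chains A p k)"
    using finite_subset finite_lists_length_le[of "from_nat ` {..<k} :: box_data set" k] by blast
  define K where "K l = (SOME s. chain A p (1 / (real k + 1)) l s) ` closure (bx 0 (hd l))" for l
  have K: "compact (K l) \<and> csec A p l ` bx 0 (hd l) \<subseteq> K l \<and> (\<exists>s. chain A p (1 / (real k + 1)) l s \<and> K l = s ` closure (bx 0 (hd l)))"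
    if l: "l \<in> level_chains A p k" for l
  proof -
    obtain s where s: "chain A p (1 / (real k + 1)) l s" "K l = s ` closure (bx 0 (hd l))"
      using l unfolding level_chains_def K_def by (metis (mono_tags, lifting) mem_Collect_eq someI_ex)
    have c: "continuous_on (bx (1 / (real k + 1)) (hd l)) s" using chain_sec[OF s(1)] unfolding sec_def by blast
    have "continuous_on (closure (bx 0 (hd l))) s"
      by (rule continuous_on_subset[OF c closure_bx_subset]) simp
    moreover have "compact (closure (bx 0 (hd l)))" by (simp add: compact_closure)
    ultimately have "compact (K l)" unfolding s(2) by (rule compact_continuous_image)
    moreover have "csec A p l z \<in> K l" if "z \<in> bx 0 (hd l)" for z
      using csec_eq[OF E s(1) _ that] closure_subset that unfolding s(2) by (simp, blast)
    ultimately show ?thesis using s by blast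
  qed
  have "closed (\<Union>l\<in>level_chains A p k. K l)" using fin K by (intro closed_UN) (auto intro: compact_imp_closed)
  moreover have "region A p k \<subseteq> (\<Union>l\<in>level_chains A p k. K l)" unfolding region_def using K by blast
  ultimately have "x \<in> (\<Union>l\<in>level_chains A p k. K l)" using closure_minimal x by blast
  then show ?thesis using K that by blast
qed

lemma Delta_simps [simp]: "open Delta" "convex Delta" "bounded Delta" "connected Delta" "0 \<in> Delta"
  unfolding Delta_def by (auto intro: convex_connected)

text \<open>The order of quantifiers matters: \<open>k'\<close> does not depend on the surface \<open>p\<close>.\<close>
lemma fill_region:
  "\<exists>k'>k. \<forall>p. etale Delta p \<longrightarrow> closure (region Delta p k \<union> inside (region Delta p k)) \<subseteq> region Delta p k'"
proof -
  define \<eta> where "\<eta> = 1 / (real k + 1)"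
  have \<eta>: "\<eta> > 0" unfolding \<eta>_def by simp
  obtain h where h: "h > 0" and round: "\<And>M. \<exists>G. finite G \<and> (\<forall>w T. 0 \<le> T \<longrightarrow> \<bar>Re w\<bar> \<le> M \<longrightarrow> \<bar>Im w\<bar> \<le> M \<longrightarrow> Re w + T \<le> M \<longrightarrow>
       (\<exists>b\<in>G. (\<forall>t\<in>{0..T}. w + of_real t \<in> bx 0 b) \<and> bx h b \<subseteq> rect w T (\<eta> / 2)))"
    by (rule round_to_box[of "\<eta> / 2"]) (use \<eta> in auto)
  \<comment> \<open>The closure of a region of level \<open>k\<close> develops into the closures of
    the first \<open>k\<close> boxes whatever the surface, so \<open>M\<close> does not depend on
    \<open>p\<close>.\<close>
  have "bounded (\<Union>b\<in>from_nat ` {..<k}. closure (bx 0 b))"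
    by (intro bounded_UN) (auto intro: bounded_closure)
  then obtain M where M: "\<And>b z. b \<in> from_nat ` {..<k} \<Longrightarrow> z \<in> closure (bx 0 b) \<Longrightarrow> norm z \<le> M"
    unfolding bounded_iff by blast
  obtain G where G: "finite G" "\<And>w T. 0 \<le> T \<Longrightarrow> \<bar>Re w\<bar> \<le> M \<Longrightarrow> \<bar>Im w\<bar> \<le> M \<Longrightarrow> Re w + T \<le> M \<Longrightarrow>
       \<exists>b\<in>G. (\<forall>t\<in>{0..T}. w + of_real t \<in> bx 0 b) \<and> bx h b \<subseteq> rect w T (\<eta> / 2)"
    using round[of M] by metis
  obtain k' where k': "k < k'" "G \<subseteq> from_nat ` {..<k'}" "1 / (real k' + 1) \<le> h"
    using ex_index[OF G(1) h] .
  have "closure (region Delta p k \<union> inside (region Delta p k)) \<subseteq> region Delta p k'" if E: "etale Delta p" for p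
  proof -
    define W where "W = region Delta p k"
    define L where "L = closure W"
    define H where "H = L \<union> inside L"
    have W: "bounded W" unfolding W_def by (rule bounded_subset[OF Delta_simps(3) region_subset])
    have L: "x \<in> Delta \<and> thick Delta p \<eta> x \<and> norm (p x) \<le> M" if x: "x \<in> L" for x
    proof -
      obtain l s z where l: "l \<in> level_chains Delta p k" "chain Delta p \<eta> l s" "z \<in> closure (bx 0 (hd l))" "x = s z"
        using closure_region[OF E] x unfolding L_def W_def \<eta>_def by metis
      have s: "sec Delta p (bx \<eta> (hd l)) s" using chain_sec[OF l(2)] .
      have z: "z \<in> bx \<eta> (hd l)" using closure_bx_subset[OF \<eta>] l(3) by blast
      have pz: "p x = z" using s z l(4) unfolding sec_def by blast
      have "sec Delta p (rect (p x) 0 \<eta>) s"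
        using sec_subset[OF s] rect_subset_bx[OF l(3)] pz by blast
      have "hd l \<in> from_nat ` {..<k}"
        using l(1) chain_Nil[OF l(2)] hd_in_set unfolding level_chains_def by blast
      then have "norm z \<le> M" using M l(3) by blast
      moreover have "s (p x) = x" using pz l(4) by simp
      moreover have "x \<in> Delta" using s z l(4) unfolding sec_def by blast
      ultimately show ?thesis
        using \<open>sec Delta p (rect (p x) 0 \<eta>) s\<close> pz unfolding thick_def by metis
    qed
    have "compact L" unfolding L_def using W by (simp add: compact_closure)
    \<comment> \<open>As \<open>Delta\<close> is convex, its complement lies in
      \<open>outside L\<close>.\<close>
    have "inside L \<subseteq> Delta"
      using outside_subset_convex[of Delta L] L inside_Int_outside[of L] Delta_simps(2) by blast
    have "closed H" unfolding H_def union_with_inside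
      using open_outside[of L] by (simp add: L_def closed_Compl)
    moreover have "bounded H" unfolding H_def
      using \<open>compact L\<close> bounded_inside[of L] by (simp add: compact_imp_bounded)
    ultimately have "compact H" by (simp add: compact_eq_bounded_closed)
    have "H \<subseteq> Delta" unfolding H_def using L \<open>inside L \<subseteq> Delta\<close> by blast
    have int: "inside L \<subseteq> interior H"
      using open_inside[of L] unfolding H_def L_def by (intro interior_maximal) auto
    have fr: "frontier H \<subseteq> L"
      using int \<open>closed H\<close> unfolding frontier_def closure_closed[OF \<open>closed H\<close>] by (auto simp: H_def)
    have th: "thick Delta p (\<eta> / 2) x" if "x \<in> H" for x
      by (rule thick_inside[OF E \<open>compact H\<close> \<open>H \<subseteq> Delta\<close> fr _ \<eta> that]) (use L in blast)
    \<comment> \<open>The real part of a local homeomorphism has no interior minimum, so its minimum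
      over \<open>H\<close> is attained on \<open>L\<close>. The upper bound comes from the right
      end of the horizontal segment, which lies over \<open>L\<close>.\<close>
    have lower: "- M \<le> Re (p x)" if x: "x \<in> H" for x
    proof -
      have "continuous_on H (\<lambda>x. Re (p x))"
        using E \<open>H \<subseteq> Delta\<close> continuous_on_subset unfolding etale_def by (blast intro: continuous_on_Re)
      then obtain m where m: "m \<in> H" "\<And>y. y \<in> H \<Longrightarrow> Re (p m) \<le> Re (p y)"
        using continuous_attains_inf[OF \<open>compact H\<close>] x by (metis empty_iff)
      have "m \<in> L"
      proof (rule ccontr)
        assume "m \<notin> L"
        then have mi: "m \<in> interior H" using int m(1) unfolding H_def by blast
        obtain s where s: "sec Delta p (rect (p m) 0 (\<eta> / 2)) s" "s (p m) = m"
          using th[OF m(1)] unfolding thick_def by blast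
        have pm: "p m \<in> rect (p m) 0 (\<eta> / 2)" using \<eta> by (simp add: mem_rect0)
        have "open (rect (p m) 0 (\<eta> / 2) \<inter> s -` interior H)"
          using s(1) continuous_open_preimage[of "rect (p m) 0 (\<eta> / 2)" s "interior H"] unfolding sec_def by simp
        then obtain e where e: "e > 0" "ball (p m) e \<subseteq> rect (p m) 0 (\<eta> / 2) \<inter> s -` interior H"
          using pm mi s(2) open_contains_ball by (metis IntI vimageI)
        define y where "y = p m - of_real (e / 2)"
        have "y \<in> ball (p m) e" using e(1) unfolding y_def by (simp add: dist_norm)
        then have "y \<in> rect (p m) 0 (\<eta> / 2)" "s y \<in> H" using e(2) interior_subset by blast+
        moreover from this have "p (s y) = y" using s(1) unfolding sec_def by blast
        ultimately have "Re (p m) \<le> Re y" using m(2)[of "s y"] by simp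
        then show False using e(1) unfolding y_def by simp
      qed
      then have "\<bar>Re (p m)\<bar> \<le> M" using L abs_Re_le_cmod[of "p m"] by (meson order_trans)
      then show ?thesis using m(2)[OF x] by simp
    qed
    have "x \<in> region Delta p k'" if x: "x \<in> H" for x
    proof -
      obtain T t where T: "0 \<le> T" and t: "sec Delta p (rect (p x) T (\<eta> / 2)) t" "t (p x) = x"
        "t (p x + of_real T) \<in> L"
        by (rule horizontal_rect[OF E \<open>compact H\<close> \<open>H \<subseteq> Delta\<close> fr _ _ th x])
           (use \<eta> in \<open>auto simp: H_def\<close>)
      let ?v = "p x + of_real T"
      have "?v \<in> rect (p x) T (\<eta> / 2)" using T \<eta> unfolding rect_def by auto
      then have "p (t ?v) = ?v" using t(1) unfolding sec_def by blast
      then have "norm ?v \<le> M" using L[OF t(3)] by simp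
      then have "\<bar>Re ?v\<bar> \<le> M" "\<bar>Im ?v\<bar> \<le> M"
        using abs_Re_le_cmod[of ?v] abs_Im_le_cmod[of ?v] by linarith+
      then have "\<exists>b\<in>G. (\<forall>t\<in>{0..T}. p x + of_real t \<in> bx 0 b) \<and> bx h b \<subseteq> rect (p x) T (\<eta> / 2)"
        using T lower[OF x] by (intro G(2)) auto
      then obtain b where b: "b \<in> G" "\<And>t. t \<in> {0..T} \<Longrightarrow> p x + of_real t \<in> bx 0 b" "bx h b \<subseteq> rect (p x) T (\<eta> / 2)"
        by blast
      have th: "sec Delta p (bx h b) t" using sec_subset[OF t(1) b(3)] .
      have t0: "sec Delta p (bx 0 b) t" using sec_subset[OF th bx_mono] h by simp
      have ends: "p x \<in> bx 0 b" "?v \<in> bx 0 b" using b(2)[of 0] b(2)[of T] T by auto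
      \<comment> \<open>\<open>t ?v\<close> is in the closure of \<open>W\<close>, so its open
        neighbourhood, the sheet over \<open>b\<close>, meets \<open>W\<close>; there
        \<open>b\<close> is appended to a chain of level \<open>k\<close>.\<close>
      have "t ` bx 0 b \<inter> W \<noteq> {}"
        using sec_open[OF t0] t(3) ends(2) open_Int_closure_eq_empty[of "t ` bx 0 b" W] unfolding L_def by auto
      then obtain l z w where l: "l \<in> level_chains Delta p k" "z \<in> bx 0 (hd l)" "w \<in> bx 0 b" "t w = csec Delta p l z"
        unfolding W_def region_def by blast
      have "w = z" using l chains_sec[OF l(1)] t0 unfolding sec_def by metis
      then have "t ` bx 0 b \<subseteq> region Delta p k'"
        using region_extend[OF E l(1) th h l(3)] l k' subsetD[OF k'(2) b(1)] by simp
      then show ?thesis using t(2) ends(1) by (metis image_subset_iff)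
    qed
    then have "H \<subseteq> region Delta p k'" by blast
    moreover have "W \<union> inside W \<subseteq> H"
      using inside_mono[of W L] closure_subset[of W] unfolding H_def L_def by blast
    then have "closure (W \<union> inside W) \<subseteq> H" using \<open>closed H\<close> closure_minimal by blast
    ultimately show ?thesis unfolding W_def by blast
  qed
  then show ?thesis using k'(1) by blast
qed

section \<open>Brown's stretching step\<close>

definition radial :: "(real \<Rightarrow> real) \<Rightarrow> complex \<Rightarrow> complex" where
  "radial \<phi> z = of_real (\<phi> (norm z)) * sgn z"

lemma radial_0 [simp]: "radial \<phi> 0 = 0"
  unfolding radial_def by simp

lemma norm_radial: "\<phi> 0 = 0 \<Longrightarrow> 0 \<le> \<phi> (norm z) \<Longrightarrow> norm (radial \<phi> z) = \<phi> (norm z)"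
  unfolding radial_def by (cases "z = 0") (auto simp: norm_mult norm_sgn)

lemma radial_id: "\<phi> (norm z) = norm z \<Longrightarrow> radial \<phi> z = z"
  unfolding radial_def by (simp add: sgn_eq)

lemma continuous_radial:
  assumes "continuous_on UNIV \<phi>" "\<phi> 0 = 0"
  shows "continuous_on UNIV (radial \<phi>)"
proof -
  have "isCont (radial \<phi>) z" for z
  proof (cases "z = 0")
    case True
    have "isCont (\<lambda>z. \<phi> (norm z)) (0::complex)"
      using assms(1) by (intro continuous_intros isCont_o2[of _ norm \<phi>]) (auto simp: continuous_on_eq_continuous_at)
    then have "((\<lambda>z::complex. \<phi> (norm z)) \<longlongrightarrow> 0) (at 0)"
      using assms(2) by (simp add: isCont_def)
    then have "((\<lambda>z. radial \<phi> z) \<longlongrightarrow> 0) (at 0)"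
      by (rule Lim_null_comparison[rotated, OF tendsto_rabs_zero])
         (auto simp: radial_def norm_mult norm_sgn eventually_at_filter)
    then show ?thesis using True by (simp add: isCont_def)
  next
    case False
    have "isCont (\<lambda>z. \<phi> (norm z)) z"
      using assms(1) by (intro continuous_intros isCont_o2[of _ norm \<phi>]) (auto simp: continuous_on_eq_continuous_at)
    then show ?thesis unfolding radial_def using False
      by (intro continuous_intros) auto
  qed
  then show ?thesis by (simp add: continuous_at_imp_continuous_on)
qed

lemma radial_radial:
  assumes "\<phi> 0 = 0" "\<psi> 0 = 0" "0 \<le> \<phi> (norm z)" "\<psi> (\<phi> (norm z)) = norm z"
  shows "radial \<psi> (radial \<phi> z) = z"
proof (cases "z = 0")
  case False
  then have "\<phi> (norm z) > 0" using assms by (metis less_eq_real_def norm_eq_zero)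
  then have "sgn (radial \<phi> z) = sgn z"
    unfolding radial_def by (simp add: sgn_mult sgn_of_real)
  then show ?thesis
    unfolding radial_def[of \<psi>] norm_radial[where \<phi> = \<phi>, OF assms(1,3)] assms(4) by (simp add: sgn_eq)
qed simp

lemma radial_inj:
  assumes "\<phi> 0 = 0" "\<And>t. 0 \<le> t \<Longrightarrow> t \<le> \<phi> t" "\<And>t u. 0 \<le> t \<Longrightarrow> t < u \<Longrightarrow> \<phi> t < \<phi> u"
  shows "inj (radial \<phi>)"
proof (rule injI)
  fix x y assume xy: "radial \<phi> x = radial \<phi> y"
  have n: "norm (radial \<phi> z) = \<phi> (norm z)" for z
    using assms(1) assms(2)[of "norm z"] by (intro norm_radial) (auto intro: order_trans[OF norm_ge_zero])
  then have "\<phi> (norm x) = \<phi> (norm y)" using xy by metis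
  then have nn: "norm x = norm y"
    using assms(3)[of "norm x" "norm y"] assms(3)[of "norm y" "norm x"] by (metis linorder_less_linear norm_ge_zero less_irrefl)
  show "x = y"
  proof (cases "x = 0")
    case False
    then have "\<phi> (norm x) > 0" using assms(2)[of "norm x"] by (smt (verit) norm_ge_zero zero_less_norm_iff)
    then have "sgn x = sgn y" using xy nn unfolding radial_def by simp
    then show ?thesis using nn by (metis sgn_div_norm sgn_eq mult.commute nonzero_eq_divide_eq norm_eq_zero of_real_eq_0_iff)
  qed (use nn in auto)
qed

text \<open>The piecewise linear self-map of \<open>[0, \<infinity>)\<close> taking \<open>a\<close> to \<open>b\<close> and fixing \<open>0\<close> and everything beyond \<open>R\<close>.\<close>
definition bend :: "real \<Rightarrow> real \<Rightarrow> real \<Rightarrow> real \<Rightarrow> real" where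
  "bend a b R t = (if t \<le> a then t * (b / a) else if t \<le> R then b + (t - a) * ((R - b) / (R - a)) else t)"

lemma continuous_bend:
  assumes "0 < a" "a < R" shows "continuous_on UNIV (bend a b R)"
  unfolding bend_def[abs_def]
  by (intro continuous_on_cases_le continuous_intros) (use assms in auto)

lemma bend_bend:
  assumes "0 < a" "a < R" "0 < b" "b < R" "0 \<le> t"
  shows "bend b a R (bend a b R t) = t" "0 \<le> bend a b R t" "t \<le> R \<Longrightarrow> bend a b R t \<le> R"
    "t \<le> a \<Longrightarrow> bend a b R t \<le> b"
proof -
  consider "t \<le> a" | "a < t" "t \<le> R" | "R < t" by linarith
  then have "bend b a R (bend a b R t) = t \<and> 0 \<le> bend a b R t \<and> (t \<le> R \<longrightarrow> bend a b R t \<le> R) \<and> (t \<le> a \<longrightarrow> bend a b R t \<le> b)"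
  proof cases
    case 1
    have "t * (b / a) \<le> b" using 1 assms by (simp add: pos_divide_le_eq mult.commute)
    then show ?thesis using 1 assms unfolding bend_def by auto
  next
    case 2
    define m where "m = (R - b) / (R - a)"
    have m: "0 < m" "m * (R - a) = R - b" "(R - a) / (R - b) = 1 / m"
      using assms unfolding m_def by auto
    define x where "x = (t - a) * m"
    have x: "0 < x" "x \<le> R - b" "x * (1 / m) = t - a"
      using 2 m mult_left_mono[of "t - a" "R - a" m] unfolding x_def by (auto simp: mult.commute)
    have v: "bend a b R t = b + x" using 2 unfolding bend_def m_def[symmetric] x_def by simp
    have "bend b a R (b + x) = a + x * (1 / m)"
      using x(1,2) unfolding bend_def m(3) by simp
    then show ?thesis using 2 assms x v by simp
  next
    case 3
    then show ?thesis using assms unfolding bend_def by auto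
  qed
  then show "bend b a R (bend a b R t) = t" "0 \<le> bend a b R t" "t \<le> R \<Longrightarrow> bend a b R t \<le> R"
    "t \<le> a \<Longrightarrow> bend a b R t \<le> b" by auto
qed

text \<open>The step in Brown's theorem that a monotone union of open cells is an open cell. With \<open>s\<close> shrinking the
  disk of radius \<open>r\<close>, transported to \<open>\<sigma>\<close> by \<open>g\<close>, and \<open>\<tau>\<close> a radial stretching in the target that is the
  identity near \<open>g 0\<close>, the new embedding is \<open>\<sigma>\<inverse> \<circ> \<tau> \<circ> \<sigma> \<circ> g = \<sigma>\<inverse> \<circ> \<tau> \<circ> g \<circ> s\<close>.\<close>
lemma stretch_embedding_cball:
  fixes g :: "complex \<Rightarrow> complex"
  assumes g: "continuous_on (ball 0 1) g" "inj_on g (ball 0 1)"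
    and rR: "0 < r" "r < R" "R < 1" and C: "bounded C"
  obtains F where "continuous_on (ball 0 1) F" "inj_on F (ball 0 1)"
    "\<And>z. z \<in> cball 0 r \<Longrightarrow> F z = g z" "C \<subseteq> F ` cball 0 R"
proof -
  let ?D = "ball (0::complex) 1"
  define q where "q = g 0"
  have subD: "cball 0 R \<subseteq> ?D" "ball 0 R \<subseteq> ?D" using rR by auto
  have opg: "open (g ` ball 0 R)"
    using invariance_of_domain continuous_on_subset[OF g(1) subD(2)] inj_on_subset[OF g(2) subD(2)] by blast
  moreover have "q \<in> g ` ball 0 R" using rR unfolding q_def by auto
  ultimately obtain \<delta> where \<delta>: "\<delta> > 0" "cball q \<delta> \<subseteq> g ` ball 0 R"
    using open_contains_cball by blast
  \<comment> \<open>The shrunken disk must be mapped into the half-size ball, on which the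
    stretching is the identity.\<close>
  obtain r' where r': "0 < r'" "r' < R" "g ` cball 0 r' \<subseteq> cball q (\<delta> / 2)"
  proof -
    have "isCont g 0" using g(1) by (simp add: continuous_on_eq_continuous_at)
    then obtain d where d: "d > 0" "\<And>z. dist z 0 < d \<Longrightarrow> dist (g z) (g 0) < \<delta> / 2"
      using \<delta>(1) unfolding continuous_at_eps_delta by (metis half_gt_zero)
    show ?thesis
      by (rule that[of "min (d / 2) (r / 2)"]) (use d rR in \<open>auto simp: q_def dist_commute less_imp_le\<close>)
  qed
  define K where "K = g ` cball 0 R"
  have cK: "compact K" unfolding K_def
    using continuous_on_subset[OF g(1) subD(1)] by (intro compact_continuous_image) auto
  then have "bounded (C \<union> K)" using C compact_imp_bounded by auto
  then obtain M0 where M0: "C \<union> K \<subseteq> cball q M0"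
    using bounded_any_center[of "C \<union> K" q] by (auto simp: subset_iff)
  \<comment> \<open>The stretched ball has to contain both \<open>C\<close> and \<open>K\<close>;
    \<open>\<delta> < M\<close> makes the slope \<open>c\<close> below positive.\<close>
  define M where "M = max M0 (\<delta> + 1)"
  have M: "C \<union> K \<subseteq> cball q M" "\<delta> < M" using M0 unfolding M_def by auto
  define s where "s = radial (bend r r' R)"
  define k where "k = radial (bend r' r R)"
  have b0: "bend a b R 0 = 0" if "0 < a" for a b using that unfolding bend_def by simp
  have cs: "continuous_on UNIV s" "continuous_on UNIV k"
    unfolding s_def k_def using rR r' b0 by (auto intro!: continuous_radial continuous_bend)
  have bb: "0 \<le> bend r r' R (norm z)" "0 \<le> bend r' r R (norm z)" for z :: complex
    using bend_bend(2) rR r' by auto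
  have ks: "k (s z) = z" and sk: "s (k z) = z" for z
    unfolding s_def k_def using rR r' b0 bb bend_bend(1) by (auto intro!: radial_radial)
  have nR: "s z \<in> cball 0 R" "k z \<in> cball 0 R" if "z \<in> cball 0 R" for z
    using that bend_bend(3) rR r' b0 bb unfolding s_def k_def by (auto simp: norm_radial)
  have sr: "s z \<in> cball 0 r'" if "z \<in> cball 0 r" for z
    using that bend_bend(4) rR r' b0 bb unfolding s_def by (auto simp: norm_radial)
  have out: "s z = z" "k z = z" if "norm z \<ge> R" for z
  proof -
    have "bend a b R (norm z) = norm z" if "a < R" for a b
      using that \<open>norm z \<ge> R\<close> unfolding bend_def by (cases "norm z = R") auto
    then show "s z = z" "k z = z" unfolding s_def k_def using rR r' by (auto intro!: radial_id)
  qed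
  have sD: "s z \<in> ?D" if "z \<in> ?D" for z
    using nR(1)[of z] out(1)[of z] that rR by (cases "norm z \<le> R") auto
  obtain gi where gi: "homeomorphism (cball 0 R) K g gi"
    unfolding K_def using homeomorphism_compact[of "cball 0 R" g K] continuous_on_subset[OF g(1) subD(1)]
      inj_on_subset[OF g(2) subD(1)] unfolding K_def by auto
  \<comment> \<open>\<open>\<sigma>i\<close> undoes the shrinking in the target: on \<open>K\<close>
    it is \<open>k\<close> conjugated by \<open>g\<close>, elsewhere the identity. The two match
    because \<open>k\<close> fixes the circle of radius \<open>R\<close>.\<close>
  define \<sigma>i where "\<sigma>i x = (if x \<in> K then g (k (gi x)) else x)" for x
  have gi_mem: "gi x \<in> cball 0 R" "g (gi x) = x" if "x \<in> K" for x
    using gi that unfolding homeomorphism_def by auto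
  have gig: "gi (g z) = z" if "z \<in> cball 0 R" for z
    using gi that homeomorphism_apply1 by blast
  have \<sigma>g: "\<sigma>i (g z) = g (k z)" if "z \<in> cball 0 R" for z
    using that gig unfolding \<sigma>i_def K_def by auto
  have c\<sigma>: "continuous_on UNIV \<sigma>i"
  proof -
    have "continuous_on (K \<union> closure (- K)) (\<lambda>x. if x \<in> K then g (k (gi x)) else x)"
    proof (rule continuous_on_cases)
      have cgi: "continuous_on K gi" using gi homeomorphism_cont2 by blast
      have "continuous_on K (\<lambda>x. k (gi x))"
        by (rule continuous_on_compose2[OF cs(2) cgi]) auto
      then show "continuous_on K (\<lambda>x. g (k (gi x)))"
        by (rule continuous_on_compose2[OF continuous_on_subset[OF g(1) subD(1)]]) (use nR gi_mem in auto)
      show "\<forall>x. x \<in> K \<and> x \<notin> K \<or> x \<in> closure (- K) \<and> x \<in> K \<longrightarrow> g (k (gi x)) = x"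
      proof (intro allI impI)
        fix x assume "x \<in> K \<and> x \<notin> K \<or> x \<in> closure (- K) \<and> x \<in> K"
        then have x: "x \<in> closure (- K)" "x \<in> K" by auto
        have "\<not> norm (gi x) < R"
        proof
          assume "norm (gi x) < R"
          then have "x \<in> g ` ball 0 R" using gi_mem[OF x(2)] by (metis image_eqI mem_ball_0)
          moreover have "g ` ball 0 R \<subseteq> K" unfolding K_def by auto
          then have "g ` ball 0 R \<inter> closure (- K) = {}"
            using open_Int_closure_eq_empty[OF opg] by auto
          ultimately show False using x by blast
        qed
        then show "g (k (gi x)) = x" using out(2) gi_mem[OF x(2)] by simp
      qed
    qed (use cK compact_imp_closed in \<open>auto intro: continuous_intros\<close>)
    moreover have "K \<union> closure (- K) = UNIV" using closure_subset[of "- K"] by blast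
    ultimately show ?thesis unfolding \<sigma>i_def[abs_def] by simp
  qed
  have \<sigma>K: "\<sigma>i x \<in> K \<longleftrightarrow> x \<in> K" for x
    using gi_mem nR unfolding \<sigma>i_def K_def by auto
  have i\<sigma>: "inj \<sigma>i"
  proof (rule injI)
    fix x y assume xy: "\<sigma>i x = \<sigma>i y"
    show "x = y"
    proof (cases "x \<in> K")
      case True
      then have y: "y \<in> K" using \<sigma>K xy by metis
      then have "g (k (gi x)) = g (k (gi y))" using xy True unfolding \<sigma>i_def by simp
      then have "k (gi x) = k (gi y)"
        using g(2) nR(2)[OF gi_mem(1)[OF True]] nR(2)[OF gi_mem(1)[OF y]] subD by (meson inj_onD subsetD)
      then show ?thesis using sk gi_mem(2)[OF True] gi_mem(2)[OF y] by metis
    next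
      case False
      then show ?thesis using \<sigma>K xy unfolding \<sigma>i_def by metis
    qed
  qed
  \<comment> \<open>With this slope \<open>\<phi>\<close> carries \<open>\<delta>\<close> to
    \<open>M\<close> while fixing everything up to \<open>\<delta> / 2\<close>.\<close>
  define c where "c = 2 * (M - \<delta>) / \<delta>"
  have c: "c > 0" "c * (\<delta> / 2) = M - \<delta>" using \<delta> M unfolding c_def by auto
  define \<phi> where "\<phi> t = t + c * max 0 (t - \<delta> / 2)" for t
  have \<phi>0: "\<phi> 0 = 0" using \<delta> unfolding \<phi>_def by simp
  have c\<phi>: "continuous_on S \<phi>" for S unfolding \<phi>_def by (intro continuous_intros)
  have \<phi>ge: "t \<le> \<phi> t" for t using c(1) unfolding \<phi>_def by simp
  have \<phi>mono: "\<phi> t < \<phi> u" if "t < u" for t u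
  proof -
    have "max 0 (t - \<delta> / 2) \<le> max 0 (u - \<delta> / 2)" using that by auto
    then have "c * max 0 (t - \<delta> / 2) \<le> c * max 0 (u - \<delta> / 2)" using c(1) by (intro mult_left_mono) auto
    then show ?thesis using that unfolding \<phi>_def by linarith
  qed
  define \<tau> where "\<tau> x = q + radial \<phi> (x - q)" for x
  have c\<tau>: "continuous_on UNIV \<tau>" unfolding \<tau>_def
    by (intro continuous_intros continuous_on_compose2[OF continuous_radial[OF c\<phi> \<phi>0]]) auto
  have i\<tau>: "inj \<tau>"
    using radial_inj[of \<phi>, OF \<phi>0 \<phi>ge \<phi>mono] unfolding \<tau>_def inj_def by (metis add_left_cancel diff_add_cancel)
  have \<tau>id: "\<tau> x = x" if "x \<in> cball q (\<delta> / 2)" for x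
  proof -
    have "\<phi> (norm (x - q)) = norm (x - q)" using that unfolding \<phi>_def by (simp add: dist_norm norm_minus_commute)
    then show ?thesis unfolding \<tau>_def by (simp add: radial_id)
  qed
  have \<tau>cov: "\<exists>y\<in>cball q \<delta>. \<tau> y = x" if x: "x \<in> cball q M" for x
  proof -
    have "max 0 (\<delta> - \<delta> / 2) = \<delta> / 2" using \<delta>(1) by simp
    then have "\<phi> \<delta> = \<delta> + (M - \<delta>)" unfolding \<phi>_def using c(2) by metis
    then have "\<phi> \<delta> = M" by simp
    then have "\<exists>t\<ge>0. t \<le> \<delta> \<and> \<phi> t = norm (x - q)"
      using IVT'[of \<phi> 0 "norm (x - q)" \<delta>] x \<phi>0 \<delta> c\<phi> by (auto simp: dist_norm norm_minus_commute)
    then obtain t where t: "0 \<le> t" "t \<le> \<delta>" "\<phi> t = norm (x - q)" by blast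
    define y where "y = q + of_real t * sgn (x - q)"
    have "\<tau> y = x"
    proof (cases "x = q")
      case True
      then show ?thesis unfolding y_def \<tau>_def by simp
    next
      case False
      then have "t \<noteq> 0" using t \<phi>0 by auto
      then have "norm (of_real t * sgn (x - q)) = t" "sgn (of_real t * sgn (x - q)) = sgn (x - q)"
        using t False by (auto simp: norm_mult norm_sgn sgn_mult sgn_of_real)
      then show ?thesis unfolding y_def \<tau>_def radial_def using t by (simp add: sgn_eq)
    qed
    moreover have "y \<in> cball q \<delta>"
      using t unfolding y_def by (auto simp: dist_norm norm_mult norm_sgn)
    ultimately show ?thesis by blast
  qed
  define F where "F z = \<sigma>i (\<tau> (g (s z)))" for z
  have "continuous_on ?D (\<lambda>z. g (s z))"
    by (rule continuous_on_compose2[OF g(1) continuous_on_subset[OF cs(1)]]) (use sD in auto)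
  then have "continuous_on ?D (\<lambda>z. \<tau> (g (s z)))"
    by (rule continuous_on_compose2[OF c\<tau>]) auto
  then have "continuous_on ?D F"
    unfolding F_def by (rule continuous_on_compose2[OF c\<sigma>]) auto
  moreover have "inj_on F ?D"
  proof (rule inj_onI)
    fix x y assume xy: "x \<in> ?D" "y \<in> ?D" "F x = F y"
    then have "g (s x) = g (s y)" using i\<sigma> i\<tau> unfolding F_def inj_def by metis
    then have "s x = s y" using inj_onD[OF g(2)] sD xy by blast
    then show "x = y" using ks by metis
  qed
  moreover have "F z = g z" if "z \<in> cball 0 r" for z
  proof -
    have "g (s z) \<in> cball q (\<delta> / 2)" using sr[OF that] r'(3) by blast
    then have "F z = \<sigma>i (g (s z))" unfolding F_def using \<tau>id by simp
    also have "\<dots> = g z" using \<sigma>g[OF nR(1)] ks that rR by auto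
    finally show ?thesis .
  qed
  moreover have "C \<subseteq> F ` cball 0 R"
  proof
    fix x assume x: "x \<in> C"
    \<comment> \<open>\<open>\<sigma>i\<close> maps \<open>K\<close> onto itself and is the identity
      off it, so points of \<open>C\<close> have preimages in \<open>C \<union> K\<close>, which
      lies in the ball of radius \<open>M\<close>.\<close>
    have "\<exists>x'\<in>cball q M. \<sigma>i x' = x"
    proof (cases "x \<in> K")
      case True
      then have z: "gi x \<in> cball 0 R" "g (gi x) = x" using gi_mem by auto
      have "g (s (gi x)) \<in> K" unfolding K_def using nR(1)[OF z(1)] by blast
      moreover have "\<sigma>i (g (s (gi x))) = x" using \<sigma>g[OF nR(1)[OF z(1)]] ks z by simp
      ultimately show ?thesis using M(1) by blast
    next
      case False
      then show ?thesis using x M(1) unfolding \<sigma>i_def by auto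
    qed
    then obtain x' y where "x' \<in> cball q M" "\<sigma>i x' = x" "y \<in> cball q \<delta>" "\<tau> y = x'"
      using \<tau>cov by blast
    moreover from this obtain w where w: "w \<in> ball 0 R" "y = g w" using \<delta>(2) by blast
    ultimately have "F (k w) = x" unfolding F_def sk by simp
    moreover have "k w \<in> cball 0 R" using nR(2)[of w] w by auto
    ultimately show "x \<in> F ` cball 0 R" by blast
  qed
  ultimately show ?thesis using that by blast
qed

text \<open>Aiming at the radius halfway between \<open>r\<close> and \<open>R\<close> trades the
  closed disk for an open one.\<close>

lemma stretch_embedding:
  fixes g :: "complex \<Rightarrow> complex"
  assumes g: "continuous_on (ball 0 1) g" "inj_on g (ball 0 1)"
    and rR: "0 < r" "r < R" "R < 1" and C: "bounded C"
  obtains F where "continuous_on (ball 0 1) F" "inj_on F (ball 0 1)"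
    "\<And>z. z \<in> cball 0 r \<Longrightarrow> F z = g z" "C \<subseteq> F ` ball 0 R"
proof -
  obtain F where F: "continuous_on (ball 0 1) F" "inj_on F (ball 0 1)"
    "\<And>z. z \<in> cball 0 r \<Longrightarrow> F z = g z" "C \<subseteq> F ` cball 0 ((r + R) / 2)"
    by (rule stretch_embedding_cball[OF g _ _ _ C, of r "(r + R) / 2"]) (use rR in auto)
  have "cball (0::complex) ((r + R) / 2) \<subseteq> ball 0 R" using rR by auto
  then show ?thesis using that F by (meson image_mono order_trans)
qed

section \<open>Orientation\<close>

definition positive_at :: "complex set \<Rightarrow> (complex \<Rightarrow> complex) \<Rightarrow> complex \<Rightarrow> bool" where
  "positive_at U f x \<longleftrightarrow> (\<exists>r>0. cball x r \<subseteq> U \<and> inj_on f (cball x r) \<and>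
     homotopic_loops (- {f x}) (f \<circ> circ x r) (circ (f x) 1))"

lemma orientation_preserving_iff: "orientation_preserving U f \<longleftrightarrow> (\<forall>x\<in>U. positive_at U f x)"
  unfolding orientation_preserving_def positive_at_def ..

lemma homotopic_loops_translate:
  fixes a b :: complex
  assumes "homotopic_loops (- {a}) p q"
  shows "homotopic_loops (- {b}) (\<lambda>t. p t + (b - a)) (\<lambda>t. q t + (b - a))"
proof -
  have "homotopic_loops (- {b}) ((\<lambda>z. z + (b - a)) \<circ> p) ((\<lambda>z. z + (b - a)) \<circ> q)"
    by (rule homotopic_loops_continuous_image[OF assms]) (auto intro!: continuous_intros)
  then show ?thesis by (simp add: o_def)
qed

lemma circ_mem_cball: "0 \<le> r \<Longrightarrow> circ x r t \<in> cball x r"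
  unfolding circ_def by (simp add: dist_norm norm_mult)

text \<open>Centre and radius move linearly. Convexity keeps the circles in \<open>S\<close>, and
  injectivity keeps the image of each circle away from that of its centre.\<close>

lemma homotopic_circles:
  fixes f :: "complex \<Rightarrow> complex"
  assumes S: "convex S" "continuous_on S f" "inj_on f S" and r: "0 < r" "0 < r'"
    and sub: "cball x r \<subseteq> S" "cball x' r' \<subseteq> S"
  shows "homotopic_loops (- {0}) (\<lambda>t. f (circ x r t) - f x) (\<lambda>t. f (circ x' r' t) - f x')"
proof -
  define c where "c u = (1 - u) *\<^sub>R x + u *\<^sub>R x'" for u :: real
  define \<rho> where "\<rho> u = (1 - u) * r + u * r'" for u :: real
  define h where "h = (\<lambda>y. f (circ (c (fst y)) (\<rho> (fst y)) (snd y)) - f (c (fst y)))"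
  have mem: "circ (c u) (\<rho> u) t \<in> S" "c u \<in> S" "circ (c u) (\<rho> u) t \<noteq> c u" if u: "u \<in> {0..1}" for u t
  proof -
    have "circ (c u) (\<rho> u) t = (1 - u) *\<^sub>R circ x r t + u *\<^sub>R circ x' r' t"
      unfolding circ_def c_def \<rho>_def by (simp add: scaleR_conv_of_real algebra_simps)
    moreover have "circ x r t \<in> S" "circ x' r' t \<in> S" using circ_mem_cball sub r by (meson less_imp_le subsetD)+
    ultimately show "circ (c u) (\<rho> u) t \<in> S" using S(1) u by (auto simp: convex_alt)
    have "x \<in> S" "x' \<in> S" using sub r by auto
    then show "c u \<in> S" using S(1) u unfolding c_def by (auto simp: convex_alt)
    have "\<rho> u > 0"
    proof (cases "u = 0")
      case False
      then have "u * r' > 0" "(1 - u) * r \<ge> 0" using u r by auto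
      then show ?thesis unfolding \<rho>_def by linarith
    qed (use r in \<open>simp add: \<rho>_def\<close>)
    then show "circ (c u) (\<rho> u) t \<noteq> c u" unfolding circ_def by simp
  qed
  let ?Q = "{0..1} \<times> {0..1} :: (real \<times> real) set"
  have "continuous_on ?Q (\<lambda>y. circ (c (fst y)) (\<rho> (fst y)) (snd y))"
    unfolding circ_def c_def \<rho>_def cis_conv_exp by (intro continuous_intros)
  moreover have "continuous_on ?Q (\<lambda>y. c (fst y))" unfolding c_def by (intro continuous_intros)
  ultimately have "continuous_on ?Q h"
    unfolding h_def
    by (intro continuous_on_diff; elim continuous_on_compose2[OF S(2)]) (auto intro: mem)
  moreover have "h ` ?Q \<subseteq> - {0}"
  proof clarify
    fix u t :: real assume ut: "u \<in> {0..1}" "t \<in> {0..1}" "h (u, t) = 0"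
    then have "f (circ (c u) (\<rho> u) t) = f (c u)" unfolding h_def by simp
    then show False using inj_onD[OF S(3) _ mem(1,2)[OF ut(1)]] mem(3)[OF ut(1)] by metis
  qed
  moreover have "h (0, t) = f (circ x r t) - f x" "h (1, t) = f (circ x' r' t) - f x'" for t
    unfolding h_def c_def \<rho>_def by simp_all
  moreover have "h (u, 1) = h (u, 0)" for u unfolding h_def circ_def by simp
  ultimately show ?thesis
    unfolding homotopic_loops by (intro exI[of _ h]) (auto simp: pathstart_def pathfinish_def)
qed

lemma positive_at_iff:
  "positive_at U f x \<longleftrightarrow> (\<exists>r>0. cball x r \<subseteq> U \<and> inj_on f (cball x r) \<and>
     homotopic_loops (- {0}) (\<lambda>t. f (circ x r t) - f x) (circ 0 1))"
proof -
  have e: "circ (f x) 1 = (\<lambda>t. circ 0 1 t + f x)" unfolding circ_def by auto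
  have "homotopic_loops (- {f x}) (f \<circ> circ x r) (circ (f x) 1) \<longleftrightarrow>
     homotopic_loops (- {0}) (\<lambda>t. f (circ x r t) - f x) (circ 0 1)" for r
  proof
    assume "homotopic_loops (- {f x}) (f \<circ> circ x r) (circ (f x) 1)"
    from homotopic_loops_translate[OF this, of 0]
    show "homotopic_loops (- {0}) (\<lambda>t. f (circ x r t) - f x) (circ 0 1)" unfolding e by simp
  next
    assume "homotopic_loops (- {0}) (\<lambda>t. f (circ x r t) - f x) (circ 0 1)"
    from homotopic_loops_translate[OF this, of "f x"]
    show "homotopic_loops (- {f x}) (f \<circ> circ x r) (circ (f x) 1)" unfolding e by (simp add: o_def)
  qed
  then show ?thesis unfolding positive_at_def by simp
qed

text \<open>The circle witnessing positivity at \<open>y\<close> may leave the ball around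
  \<open>x\<close>, so it is shrunk first and only then moved to \<open>z\<close> within that
  ball.\<close>

lemma positive_transfer:
  assumes f: "continuous_on U f" and B: "cball x R \<subseteq> U" "inj_on f (cball x R)"
    and y: "y \<in> ball x R" "positive_at U f y" and z: "z \<in> ball x R"
  shows "positive_at U f z"
proof -
  obtain r where r: "r > 0" "cball y r \<subseteq> U" "inj_on f (cball y r)"
    "homotopic_loops (- {0}) (\<lambda>t. f (circ y r t) - f y) (circ 0 1)"
    using y(2) unfolding positive_at_iff by blast
  define e where "e = min r ((R - dist x y) / 2)"
  define d where "d = (R - dist x z) / 2"
  have e: "e > 0" "cball y e \<subseteq> cball y r" "d > 0" using r y z unfolding e_def d_def by auto
  have "dist x w \<le> R" if "dist y w \<le> e" for w
    using dist_triangle[of x w y] that e y unfolding e_def by (simp add: dist_commute)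
  then have ye: "cball y e \<subseteq> cball x R" by auto
  have "dist x w \<le> R" if "dist z w \<le> d" for w
    using dist_triangle[of x w z] that e z unfolding d_def by (simp add: dist_commute)
  then have zd: "cball z d \<subseteq> cball x R" by auto
  have "homotopic_loops (- {0}) (\<lambda>t. f (circ z d t) - f z) (\<lambda>t. f (circ y e t) - f y)"
    by (rule homotopic_circles[OF _ continuous_on_subset[OF f B(1)] B(2) e(3,1) zd ye]) simp
  moreover have "homotopic_loops (- {0}) (\<lambda>t. f (circ y e t) - f y) (\<lambda>t. f (circ y r t) - f y)"
    by (rule homotopic_circles[OF _ continuous_on_subset[OF f r(2)] r(3) e(1) r(1) e(2)]) simp_all
  ultimately have "homotopic_loops (- {0}) (\<lambda>t. f (circ z d t) - f z) (circ 0 1)"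
    using r(4) homotopic_loops_trans by blast
  moreover have "inj_on f (cball z d)" using inj_on_subset[OF B(2) zd] .
  ultimately show ?thesis using e(3) zd B(1) unfolding positive_at_iff by blast
qed

text \<open>Positivity is constant near each point, so its validity and its failure are both open.
  For the limit surface this reduces orientation to the basepoint.\<close>

lemma orientation_preserving_connected:
  assumes E: "etale U f" and U: "connected U" and x0: "x0 \<in> U" "positive_at U f x0"
  shows "orientation_preserving U f"
proof -
  let ?P = "{x \<in> U. positive_at U f x}" and ?N = "{x \<in> U. \<not> positive_at U f x}"
  have loc: "\<exists>T. open T \<and> x \<in> T \<and> T \<subseteq> U \<and> (\<forall>y\<in>T. \<forall>z\<in>T. positive_at U f y \<longrightarrow> positive_at U f z)" if x: "x \<in> U" for x
  proof -
    obtain V where V: "open V" "x \<in> V" "V \<subseteq> U" "inj_on f V" using E x unfolding etale_def by blast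
    then obtain R where R: "R > 0" "cball x R \<subseteq> V" using open_contains_cball by metis
    have inj: "inj_on f (cball x R)" using inj_on_subset[OF V(4) R(2)] .
    have sub: "cball x R \<subseteq> U" using R(2) V(3) by (rule subset_trans)
    have cont: "continuous_on U f" using E unfolding etale_def by blast
    have "ball x R \<subseteq> U" using sub ball_subset_cball by (rule subset_trans[rotated])
    then show ?thesis
    proof (intro exI[of _ "ball x R"] conjI ballI impI)
      show "positive_at U f z" if "y \<in> ball x R" "z \<in> ball x R" "positive_at U f y" for y z
        using positive_transfer[OF cont sub inj that(1,3,2)] .
    qed (use R(1) in auto)
  qed
  have "open ?P"
    by (subst open_subopen) (use loc in \<open>fastforce\<close>)
  moreover have "open ?N"
    by (subst open_subopen) (use loc in \<open>fastforce\<close>)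
  ultimately have "?P \<inter> U = {} \<or> ?N \<inter> U = {}"
    by (intro connectedD[OF U]) auto
  then show ?thesis using x0 unfolding orientation_preserving_iff by blast
qed

lemma positive_at_scale:
  assumes "\<epsilon> > 0" "r > 0" "cball x r \<subseteq> U" "\<And>z. z \<in> cball x r \<Longrightarrow> f z = of_real \<epsilon> * z"
  shows "positive_at U f x"
proof -
  have "homotopic_loops (- {0}) (\<lambda>t. f (circ x r t) - f x) (\<lambda>t. circ 0 1 t - 0)"
  proof -
    have "(\<lambda>t. f (circ x r t) - f x) = (\<lambda>t. circ 0 (\<epsilon> * r) t - 0)"
    proof
      fix t show "f (circ x r t) - f x = circ 0 (\<epsilon> * r) t - 0"
        using assms(4)[of x] assms(4)[OF circ_mem_cball[of r x t]] assms(2)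
        unfolding circ_def by (simp add: algebra_simps)
    qed
    then show ?thesis
      using homotopic_circles[of UNIV "\<lambda>z. z" "\<epsilon> * r" 1 0 0] assms(1,2) by simp
  qed
  moreover have "inj_on f (cball x r)" using assms(1,4) by (intro inj_onI) simp
  ultimately show ?thesis using assms(2,3) unfolding positive_at_iff by auto
qed

section \<open>The limit surface\<close>

lemma etale_subset:
  assumes "etale A p" "open U" "U \<subseteq> A" shows "etale U p"
  unfolding etale_def
proof (intro conjI ballI)
  show "continuous_on U p" using assms continuous_on_subset unfolding etale_def by blast
  fix x assume x: "x \<in> U"
  then obtain V where V: "open V" "x \<in> V" "inj_on p V" using assms(1,3) unfolding etale_def by blast
  then show "\<exists>V. open V \<and> x \<in> V \<and> V \<subseteq> U \<and> inj_on p V"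
    using x assms(2) by (intro exI[of _ "V \<inter> U"]) (auto intro: inj_on_subset)
qed (use assms in auto)

lemma immersion_compose:
  assumes "immersion A f B g \<iota>" "immersion B g C h \<kappa>"
  shows "immersion A f C h (\<kappa> \<circ> \<iota>)"
  using assms continuous_on_compose[of A \<iota> \<kappa>] continuous_on_subset[of B \<kappa> "\<iota> ` A"]
  unfolding immersion_def by auto

text \<open>The direct limit of the \<open>\<Omega> i\<close> is realised on the unit disk itself.
  Charts turn the connecting maps into injective bounded self-maps \<open>E i\<close> of the plane,
  and stretching builds embeddings \<open>f i\<close> that follow them on growing disks. Covering
  \<open>range (E i)\<close> makes every stage embed into the limit.\<close>

lemma limit_surface:
  fixes \<psi> e :: "nat \<Rightarrow> complex \<Rightarrow> complex" and \<Omega> :: "nat \<Rightarrow> complex set"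
  assumes \<psi>: "\<And>i. etale (\<Omega> i) (\<psi> i)" "\<And>i. \<psi> i 0 = 0"
    and \<Omega>: "\<And>i. 0 \<in> \<Omega> i" "\<And>i. \<Omega> i homeomorphic ball (0::complex) 1"
    and e: "\<And>i. immersion (\<Omega> i) (\<psi> i) (\<Omega> (Suc i)) (\<psi> (Suc i)) (e i)" "\<And>i. inj_on (e i) (\<Omega> i)"
    and rc: "\<And>i. \<exists>K. compact K \<and> e i ` \<Omega> i \<subseteq> K \<and> K \<subseteq> \<Omega> (Suc i)"
  obtains \<Phi> where "pointed_lh \<Phi>"
    "\<And>r. r < 1 \<Longrightarrow> \<exists>i \<iota>. immersion (ball 0 r) \<Phi> (\<Omega> i) (\<psi> i) \<iota> \<and> inj_on \<iota> (ball 0 r)"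
    "\<And>i. \<exists>\<iota>. immersion (\<Omega> i) (\<psi> i) Delta \<Phi> \<iota> \<and> inj_on \<iota> (\<Omega> i)"
proof -
  let ?D = "ball (0::complex) 1"
  have "\<exists>b a. homeomorphism (\<Omega> i) (UNIV::complex set) b a" for i
    using homeomorphic_trans[OF \<Omega>(2)[of i] homeomorphic_ball_UNIV[of 1 0]] unfolding homeomorphic_def by simp
  then obtain a b where "\<And>i. homeomorphism (\<Omega> i) (UNIV::complex set) (b i) (a i)" by metis
  then have ab: "\<And>i x. a i x \<in> \<Omega> i" "\<And>i x. b i (a i x) = x" "\<And>i x. x \<in> \<Omega> i \<Longrightarrow> a i (b i x) = x"
    and cab: "\<And>i. continuous_on UNIV (a i)" "\<And>i. continuous_on (\<Omega> i) (b i)"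
    unfolding homeomorphism_def by auto
  have e': "\<And>i. continuous_on (\<Omega> i) (e i)" "\<And>i x. x \<in> \<Omega> i \<Longrightarrow> e i x \<in> \<Omega> (Suc i)" "\<And>i. e i 0 = 0"
    "\<And>i x. x \<in> \<Omega> i \<Longrightarrow> \<psi> (Suc i) (e i x) = \<psi> i x"
    using e(1) unfolding immersion_def by auto
  define E where "E i x = b (Suc i) (e i (a i x))" for i x
  have cE: "continuous_on UNIV (E i)" for i
  proof -
    have "continuous_on UNIV (\<lambda>x. e i (a i x))"
      by (rule continuous_on_compose2[OF e'(1) cab(1)]) (use ab in auto)
    then show ?thesis unfolding E_def by (rule continuous_on_compose2[OF cab(2)]) (use ab e' in auto)
  qed
  have iE: "inj (E i)" for i
  proof (rule injI)
    fix x y assume "E i x = E i y"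
    then have "e i (a i x) = e i (a i y)" using ab(1,3) e'(2) unfolding E_def by metis
    then have "a i x = a i y" using e(2) ab(1) by (meson inj_onD)
    then show "x = y" using ab(2) by metis
  qed
  \<comment> \<open>Relative compactness of the image in the next stage becomes boundedness in the
    chart, which the stretching requires of the set to be covered.\<close>
  have bE: "bounded (range (E i))" for i
  proof -
    obtain K where K: "compact K" "e i ` \<Omega> i \<subseteq> K" "K \<subseteq> \<Omega> (Suc i)" using rc by blast
    have "compact (b (Suc i) ` K)"
      using compact_continuous_image[OF continuous_on_subset[OF cab(2) K(3)] K(1)] .
    moreover have "range (E i) \<subseteq> b (Suc i) ` K" using K(2) ab(1) unfolding E_def by blast
    ultimately show ?thesis using compact_imp_bounded bounded_subset by blast
  qed
  define r where "r i = 1 - 1 / (real i + 2)" for i :: nat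
  have r: "0 < r i" "r i < r (Suc i)" "r i < 1" for i
    unfolding r_def by (auto simp: field_simps)
  have rmono: "r i \<le> r j" if "i \<le> j" for i j
    using that unfolding r_def by (simp add: frac_le)
  have rex: "\<exists>i. x < r i" if x: "x < 1" for x
  proof -
    obtain i :: nat where "1 / (1 - x) < real i" using reals_Archimedean2 by blast
    then have "1 / (1 - x) < real i + 2" by simp
    then have "1 < (real i + 2) * (1 - x)" using x by (simp add: pos_divide_less_eq)
    then have "1 / (real i + 2) < 1 - x" by (simp add: pos_divide_less_eq mult.commute)
    then show ?thesis unfolding r_def by (intro exI[of _ i]) simp
  qed
  obtain \<epsilon> s where s: "\<epsilon> > 0" "sec (\<Omega> 0) (\<psi> 0) (ball 0 \<epsilon>) s" "s 0 = 0"
    using local_section[OF \<psi>(1)[of 0] \<Omega>(1)] \<psi>(2)[of 0] by metis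
  \<comment> \<open>Starting from a rescaled inverse branch makes the limit map the dilation by
    \<open>\<epsilon>\<close> near \<open>0\<close>, which settles its orientation.\<close>
  define f0 where "f0 z = b 0 (s (of_real \<epsilon> * z))" for z
  have \<epsilon>z: "of_real \<epsilon> * z \<in> ball 0 \<epsilon>" if "z \<in> ?D" for z
    using that s(1) by (simp add: norm_mult)
  have sz: "s (of_real \<epsilon> * z) \<in> \<Omega> 0" "\<psi> 0 (s (of_real \<epsilon> * z)) = of_real \<epsilon> * z" if "z \<in> ?D" for z
    using s(2) \<epsilon>z[OF that] unfolding sec_def by auto
  have cf0: "continuous_on ?D f0"
  proof -
    have "continuous_on ?D (\<lambda>z. s (of_real \<epsilon> * z))"
      by (rule continuous_on_compose2[of "ball 0 \<epsilon>" s]) (use s(2) \<epsilon>z in \<open>auto simp: sec_def intro!: continuous_intros\<close>)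
    then show ?thesis unfolding f0_def by (rule continuous_on_compose2[OF cab(2)]) (use sz in auto)
  qed
  have if0: "inj_on f0 ?D"
  proof (rule inj_onI)
    fix x y assume xy: "x \<in> ?D" "y \<in> ?D" "f0 x = f0 y"
    then have "s (of_real \<epsilon> * x) = s (of_real \<epsilon> * y)" using ab(3) sz(1) unfolding f0_def by metis
    then have "of_real \<epsilon> * x = of_real \<epsilon> * y" using sz(2) xy by metis
    then show "x = y" using s(1) by simp
  qed
  have "\<exists>f. \<forall>n. (continuous_on ?D (f n) \<and> inj_on (f n) ?D \<and> (n = 0 \<longrightarrow> f n = f0)) \<and>
     ((\<forall>z\<in>cball 0 (r n). f (Suc n) z = E n (f n z)) \<and> range (E n) \<subseteq> f (Suc n) ` ball 0 (r (Suc n)))"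
  proof (rule dependent_nat_choice)
    show "\<exists>x. continuous_on ?D x \<and> inj_on x ?D \<and> ((0::nat) = 0 \<longrightarrow> x = f0)" using cf0 if0 by blast
    fix g and n :: nat assume g: "continuous_on ?D g \<and> inj_on g ?D \<and> (n = 0 \<longrightarrow> g = f0)"
    have "continuous_on ?D (\<lambda>z. E n (g z))"
      by (rule continuous_on_compose2[OF cE]) (use g in auto)
    moreover have "inj_on (\<lambda>z. E n (g z)) ?D"
      using g iE[of n] by (auto simp: inj_on_def inj_def)
    ultimately obtain F where "continuous_on ?D F" "inj_on F ?D"
        "\<And>z. z \<in> cball 0 (r n) \<Longrightarrow> F z = E n (g z)" "range (E n) \<subseteq> F ` ball 0 (r (Suc n))"
      using stretch_embedding[of "\<lambda>z. E n (g z)" "r n" "r (Suc n)" "range (E n)"] r bE by metis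
    then show "\<exists>y. (continuous_on ?D y \<and> inj_on y ?D \<and> (Suc n = 0 \<longrightarrow> y = f0)) \<and>
        (\<forall>z\<in>cball 0 (r n). y z = E n (g z)) \<and> range (E n) \<subseteq> y ` ball 0 (r (Suc n))" by blast
  qed
  then obtain f where f: "\<And>n. continuous_on ?D (f n)" "\<And>n. inj_on (f n) ?D" "f 0 = f0"
    "\<And>n z. z \<in> cball 0 (r n) \<Longrightarrow> f (Suc n) z = E n (f n z)"
    "\<And>n. range (E n) \<subseteq> f (Suc n) ` ball 0 (r (Suc n))" by metis
  \<comment> \<open>All stages \<open>n\<close> with \<open>norm z < r n\<close> give the same
    value, as shown next; \<open>LEAST\<close> merely selects one.\<close>
  define \<Phi> where "\<Phi> z = (let n = LEAST n. norm z < r n in \<psi> n (a n (f n z)))" for z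
  have \<Phi>: "\<Phi> z = \<psi> i (a i (f i z))" if z: "norm z < r i" for z i
  proof -
    define n where "n = (LEAST n. norm z < r n)"
    have n: "norm z < r n" "n \<le> i" unfolding n_def using z by (rule LeastI, rule Least_le)
    have "\<psi> j (a j (f j z)) = \<psi> n (a n (f n z))" if "n \<le> j" for j
      using that
    proof (induction rule: dec_induct)
      case (step j)
      have "z \<in> cball 0 (r j)" using n rmono[OF step(1)] by simp
      then have "f (Suc j) z = E j (f j z)" by (rule f(4))
      then have "\<psi> (Suc j) (a (Suc j) (f (Suc j) z)) = \<psi> (Suc j) (e j (a j (f j z)))"
        unfolding E_def using ab(1,3) e'(2) by simp
      then show ?case using e'(4) ab(1) step by simp
    qed simp
    from this[OF n(2)] show ?thesis unfolding \<Phi>_def n_def Let_def by (rule sym)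
  qed
  have sub: "ball 0 (r i) \<subseteq> ?D" for i using r(3)[of i] by auto
  have cfi: "continuous_on (ball 0 (r i)) (\<lambda>z. a i (f i z))" for i
    by (rule continuous_on_compose2[OF cab(1) continuous_on_subset[OF f(1) sub]]) auto
  have ifi: "inj_on (\<lambda>z. a i (f i z)) (ball 0 (r i))" for i
    using inj_on_subset[OF f(2) sub] ab(2) by (smt (verit) inj_on_def)
  have DU: "Delta = (\<Union>i. ball 0 (r i))"
    using rex sub unfolding Delta_def by fastforce
  have c\<Phi>: "continuous_on (ball 0 (r i)) \<Phi>" for i
  proof -
    have "continuous_on (ball 0 (r i)) (\<lambda>z. \<psi> i (a i (f i z)))"
      by (rule continuous_on_compose2[OF _ cfi]) (use \<psi>(1) ab(1) in \<open>auto simp: etale_def\<close>)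
    moreover have "\<And>z. z \<in> ball 0 (r i) \<Longrightarrow> \<psi> i (a i (f i z)) = \<Phi> z" using \<Phi> by simp
    ultimately show ?thesis by (rule continuous_on_eq)
  qed
  have et: "etale Delta \<Phi>"
    unfolding etale_def
  proof (intro conjI ballI)
    show "continuous_on Delta \<Phi>" unfolding DU by (intro continuous_on_open_UN c\<Phi>) auto
    fix z assume "z \<in> Delta"
    then obtain i where i: "z \<in> ball 0 (r i)" unfolding DU by blast
    obtain V where V: "open V" "a i (f i z) \<in> V" "inj_on (\<psi> i) V"
      using \<psi>(1)[of i] ab(1)[of i "f i z"] unfolding etale_def by blast
    define T where "T = ball 0 (r i) \<inter> (\<lambda>z. a i (f i z)) -` V"
    have "open T" unfolding T_def using continuous_open_preimage[OF cfi _ V(1)] by simp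
    moreover have "inj_on \<Phi> T"
    proof (rule inj_onI)
      fix x y assume xy: "x \<in> T" "y \<in> T" "\<Phi> x = \<Phi> y"
      then have "\<psi> i (a i (f i x)) = \<psi> i (a i (f i y))" using \<Phi>[of x i] \<Phi>[of y i] unfolding T_def by simp
      then have "a i (f i x) = a i (f i y)" using V(3) xy unfolding T_def by (auto dest: inj_onD)
      then show "x = y" using ifi[of i] xy unfolding T_def inj_on_def by simp
    qed
    moreover have "z \<in> T" "T \<subseteq> Delta" using i V(2) DU unfolding T_def by auto
    ultimately show "\<exists>V. open V \<and> z \<in> V \<and> V \<subseteq> Delta \<and> inj_on \<Phi> V" by blast
  qed simp
  have scale: "\<Phi> z = of_real \<epsilon> * z" if "norm z < r 0" for z
  proof -
    have "z \<in> ?D" using that r(3)[of 0] by simp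
    then show ?thesis using \<Phi>[OF that] f(3) sz ab(3) unfolding f0_def by simp
  qed
  have "positive_at Delta \<Phi> 0"
  proof (rule positive_at_scale[OF s(1), of "r 0 / 2"])
    show "cball 0 (r 0 / 2) \<subseteq> Delta" using r(1,3)[of 0] unfolding Delta_def by auto
  qed (use r(1)[of 0] scale in auto)
  then have "orientation_preserving Delta \<Phi>"
    by (intro orientation_preserving_connected[OF et]) auto
  moreover have "\<Phi> 0 = 0" using scale[of 0] r(1)[of 0] by simp
  ultimately have "pointed_lh \<Phi>"
    using et local_homeomorphism_iff_etale[of Delta] unfolding pointed_lh_def by simp
  moreover have fb: "f i 0 = b i 0" for i
  proof (induction i)
    case 0
    then show ?case using f(3) s(3) unfolding f0_def by simp
  next
    case (Suc i)
    have "f (Suc i) 0 = E i (f i 0)" using f(4)[of 0 i] r(1)[of i] by simp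
    then show ?case using Suc ab(3)[OF \<Omega>(1)] e'(3) unfolding E_def by simp
  qed
  have "\<exists>i \<iota>. immersion (ball 0 R) \<Phi> (\<Omega> i) (\<psi> i) \<iota> \<and> inj_on \<iota> (ball 0 R)" if R: "R < 1" for R
  proof -
    obtain i where i: "R < r i" using rex[OF R] by blast
    then have sub: "ball (0::complex) R \<subseteq> ball 0 (r i)" by auto
    have "immersion (ball 0 R) \<Phi> (\<Omega> i) (\<psi> i) (\<lambda>z. a i (f i z))"
      unfolding immersion_def
    proof (intro conjI ballI)
      show "continuous_on (ball 0 R) (\<lambda>z. a i (f i z))" using continuous_on_subset[OF cfi sub] .
      show "a i (f i 0) = 0" using fb ab(3) \<Omega>(1) by simp
      show "\<psi> i (a i (f i z)) = \<Phi> z" if "z \<in> ball 0 R" for z using \<Phi>[of z i] sub that by auto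
    qed (use ab(1) in auto)
    then show ?thesis using inj_on_subset[OF ifi sub] by blast
  qed
  moreover have "\<exists>\<iota>. immersion (\<Omega> i) (\<psi> i) Delta \<Phi> \<iota> \<and> inj_on \<iota> (\<Omega> i)" for i
  proof -
    let ?B = "ball (0::complex) (r (Suc i))" and ?f = "f (Suc i)"
    obtain g where g: "homeomorphism ?B (?f ` ?B) ?f g"
      using invariance_of_domain_homeomorphism[of ?B ?f] continuous_on_subset[OF f(1) sub] inj_on_subset[OF f(2) sub]
      by auto
    \<comment> \<open>Stage \<open>i\<close> enters through stage \<open>Suc i\<close>: the
      embedding \<open>?f\<close> already covers the image of \<open>E i\<close>.\<close>
    define \<iota> where "\<iota> x = g (b (Suc i) (e i x))" for x
    have mem: "b (Suc i) (e i x) \<in> ?f ` ?B" if "x \<in> \<Omega> i" for x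
    proof -
      have "b (Suc i) (e i x) = E i (b i x)" unfolding E_def using ab(3)[OF that] by simp
      then show ?thesis using f(5)[of i] by auto
    qed
    have gv: "g y \<in> ?B" "?f (g y) = y" if "y \<in> ?f ` ?B" for y
      using g that unfolding homeomorphism_def by auto
    have "immersion (\<Omega> i) (\<psi> i) Delta \<Phi> \<iota>"
      unfolding immersion_def
    proof (intro conjI ballI)
      have "continuous_on (\<Omega> i) (\<lambda>x. b (Suc i) (e i x))"
        by (rule continuous_on_compose2[OF cab(2) e'(1)]) (use e'(2) in auto)
      then show "continuous_on (\<Omega> i) \<iota>" unfolding \<iota>_def
        by (rule continuous_on_compose2[OF homeomorphism_cont2[OF g]]) (use mem in auto)
      show "\<iota> ` \<Omega> i \<subseteq> Delta" using gv(1) mem DU unfolding \<iota>_def by blast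
      have "g (?f 0) = 0" using homeomorphism_apply1[OF g, of 0] r(1)[of "Suc i"] by simp
      then show "\<iota> 0 = 0" unfolding \<iota>_def using fb e'(3) by simp
      fix x assume x: "x \<in> \<Omega> i"
      have "\<iota> x \<in> ?B" "?f (\<iota> x) = b (Suc i) (e i x)" using gv mem[OF x] unfolding \<iota>_def by auto
      then show "\<Phi> (\<iota> x) = \<psi> i x" using \<Phi>[of "\<iota> x" "Suc i"] ab(3) e'(2,4)[OF x] by simp
    qed
    moreover have "inj_on \<iota> (\<Omega> i)"
    proof (rule inj_onI)
      fix x y assume xy: "x \<in> \<Omega> i" "y \<in> \<Omega> i" "\<iota> x = \<iota> y"
      then have "b (Suc i) (e i x) = b (Suc i) (e i y)" using gv(2) mem unfolding \<iota>_def by metis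
      then have "e i x = e i y" using ab(3) e'(2) xy by metis
      then show "x = y" using e(2) xy by (meson inj_onD)
    qed
    ultimately show ?thesis by blast
  qed
  ultimately show ?thesis using that by blast
qed

section \<open>Compactness\<close>

lemma immersion_mono:
  assumes "immersion A f B g \<iota>" "A' \<subseteq> A" "\<iota> ` A' \<subseteq> B'"
  shows "immersion A' f B' g \<iota>"
  using assms continuous_on_subset unfolding immersion_def by blast

text \<open>The truth value \<open>J\<close> selects the version for embeddings.\<close>
lemma glue_levels:
  assumes B: "etale B g" "connected B" "0 \<in> B" "g 0 = 0" and \<Phi>: "etale Delta \<Phi>"
    and lev: "\<And>k. \<exists>p q \<iota> j. etale Delta p \<and> etale Delta q \<and> immersion B g Delta p \<iota> \<and> (J \<longrightarrow> inj_on \<iota> B) \<and>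
       pattern Delta p k = pattern Delta q k \<and>
       immersion (region Delta q k) q Delta \<Phi> j \<and> inj_on j (region Delta q k)"
  obtains \<iota> where "immersion B g Delta \<Phi> \<iota>" "J \<longrightarrow> inj_on \<iota> B"
proof -
  let ?I = "\<Union>k. level_chains B g k" and ?b = "\<lambda>l. bx 0 (hd l)"
  \<comment> \<open>The comparison runs from \<open>B\<close> to \<open>p\<close>, across the common
    pattern to \<open>q\<close>, and on to \<open>\<Phi>\<close>. The surfaces \<open>p\<close> and
    \<open>q\<close> vary with \<open>k\<close>, but uniqueness makes the values of
    \<open>csec Delta \<Phi> l\<close> on the last box independent of them, so the levels fit
    together.\<close>
  have level: "chain Delta \<Phi> 0 l (csec Delta \<Phi> l) \<and>
      (meets B g l l' \<longrightarrow> (\<forall>z\<in>?b l \<inter> ?b l'. csec Delta \<Phi> l z = csec Delta \<Phi> l' z)) \<and>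
      (J \<longrightarrow> meets Delta \<Phi> l l' \<longrightarrow> meets B g l l')"
    if l: "l \<in> level_chains B g k" "l' \<in> level_chains B g k" for k l l'
  proof -
    obtain p q \<iota> j where E: "etale Delta p" "etale Delta q"
      and \<iota>: "immersion B g Delta p \<iota>" "J \<longrightarrow> inj_on \<iota> B"
      and pat: "pattern Delta p k = pattern Delta q k"
      and j: "immersion (region Delta q k) q Delta \<Phi> j" "inj_on j (region Delta q k)"
      using lev[of k] by blast
    have chp: "m \<in> level_chains Delta p k" if "m \<in> level_chains B g k" for m
      using that chains_push[OF \<iota>(1)] by blast
    then have chq: "m \<in> level_chains Delta q k" if "m \<in> level_chains B g k" for m
      using that pat unfolding pattern_def by auto
    have mpq: "meets Delta p l l' \<longleftrightarrow> meets Delta q l l'"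
      using pat chp[OF l(1)] chp[OF l(2)] unfolding pattern_def by auto
    have ch: "chain Delta \<Phi> 0 m (j \<circ> csec Delta q m)" if "m \<in> level_chains B g k" for m
      using chain_push[OF j(1) order_refl chain_region[OF E(2) chq[OF that]]] .
    have val: "csec Delta \<Phi> m z = j (csec Delta q m z)" if "m \<in> level_chains B g k" "z \<in> ?b m" for m z
      using csec_eq[OF \<Phi> ch[OF that(1)] order_refl that(2)] by simp
    have "csec Delta \<Phi> l z = csec Delta \<Phi> l' z" if m: "meets B g l l'" and z: "z \<in> ?b l \<inter> ?b l'" for z
    proof -
      have "meets Delta p l l'" using meets_push[OF \<iota>(1) E(1) l m] .
      then have "csec Delta q l z = csec Delta q l' z"
        using meets_agree[OF E(2) chq[OF l(1)] chq[OF l(2)]] mpq z by blast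
      then show ?thesis using val l z by simp
    qed
    moreover have "meets B g l l'" if "J" and m: "meets Delta \<Phi> l l'"
    proof -
      obtain z where z: "z \<in> ?b l \<inter> ?b l'" "csec Delta \<Phi> l z = csec Delta \<Phi> l' z"
        using m unfolding meets_def by blast
      then have "j (csec Delta q l z) = j (csec Delta q l' z)" using val l by auto
      moreover have "csec Delta q l z \<in> region Delta q k" "csec Delta q l' z \<in> region Delta q k"
        using z(1) chq l unfolding region_def by blast+
      ultimately have "csec Delta q l z = csec Delta q l' z" using j(2) by (meson inj_onD)
      then have "meets Delta p l l'" using mpq z(1) unfolding meets_def by blast
      then show ?thesis using meets_push_inj[OF \<iota>(1) E(1) l] \<iota>(2) \<open>J\<close> by blast
    qed
    ultimately show ?thesis using chain_csec[OF ch[OF l(1)] order_refl] by blast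
  qed
  have pair: "\<exists>k. l \<in> level_chains B g k \<and> l' \<in> level_chains B g k" if ll': "l \<in> ?I" "l' \<in> ?I" for l l'
  proof -
    obtain k k' where "l \<in> level_chains B g k" "l' \<in> level_chains B g k'" using ll' by blast
    then show ?thesis using chains_mono[of k "max k k'"] chains_mono[of k' "max k k'"] by (meson max.cobounded1 max.cobounded2 subsetD)
  qed
  have ch\<Phi>: "chain Delta \<Phi> 0 l (csec Delta \<Phi> l)" if "l \<in> ?I" for l
    using that level by blast
  have secs: "sec B g (?b l) (csec B g l)" "sec Delta \<Phi> (?b l) (csec Delta \<Phi> l)" if "l \<in> ?I" for l
    using that chains_sec chain_sec[OF ch\<Phi>[OF that]] by blast+
  have agree: "csec Delta \<Phi> l z = csec Delta \<Phi> l' z"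
    if "l \<in> ?I" "l' \<in> ?I" "z \<in> ?b l" "z \<in> ?b l'" "csec B g l z = csec B g l' z" for l l' z
  proof -
    have "meets B g l l'" using that(3-5) unfolding meets_def by blast
    then show ?thesis using pair[OF that(1,2)] level that(3,4) by blast
  qed
  have dom: "(\<Union>l\<in>?I. csec B g l ` ?b l) = B"
    using region_exhausts[OF B] unfolding region_def by blast
  obtain \<iota> where \<iota>: "continuous_on B \<iota>" "\<iota> ` B \<subseteq> Delta" "\<And>x. x \<in> B \<Longrightarrow> \<Phi> (\<iota> x) = g x"
    and v: "\<And>l z. l \<in> ?I \<Longrightarrow> z \<in> ?b l \<Longrightarrow> \<iota> (csec B g l z) = csec Delta \<Phi> l z"
    using glue_immersion[of ?I ?b B g "csec B g" Delta \<Phi> "csec Delta \<Phi>", OF open_bx secs agree]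
    unfolding dom by blast
  obtain k where k: "0 \<in> region B g k" using region_exhausts[OF B] B(3) by blast
  then obtain b where b: "[b] \<in> level_chains B g k" "0 \<in> bx 0 b" "csec B g [b] 0 = 0"
    by (rule chains_singleton)
  have "csec Delta \<Phi> [b] 0 = 0" using ch\<Phi>[of "[b]"] b(1) by auto
  then have "\<iota> 0 = 0" using v[of "[b]" 0] b by auto
  moreover have "inj_on \<iota> B" if "J"
  proof (rule inj_onI)
    fix x y assume xy: "x \<in> B" "y \<in> B" "\<iota> x = \<iota> y"
    obtain l z where l: "l \<in> ?I" "z \<in> ?b l" "x = csec B g l z" using xy(1) dom by blast
    obtain l' z' where l': "l' \<in> ?I" "z' \<in> ?b l'" "y = csec B g l' z'" using xy(2) dom by blast
    have "g x = g y" using \<iota>(3) xy by metis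
    then have z: "z = z'" using l l' secs(1) unfolding sec_def by metis
    have eq: "csec Delta \<Phi> l z = csec Delta \<Phi> l' z" using v[OF l(1,2)] v[OF l'(1,2)] xy(3) l(3) l'(3) z by simp
    obtain k where k: "l \<in> level_chains B g k" "l' \<in> level_chains B g k" using pair[OF l(1) l'(1)] by blast
    have "meets Delta \<Phi> l l'" using eq l(2) l'(2) z unfolding meets_def by blast
    then have "meets B g l l'" using level[OF k] that by blast
    then show "x = y" using meets_agree[OF B(1) k _ l(2)] l' l(3) z by simp
  qed
  ultimately show ?thesis using that \<iota> unfolding immersion_def by blast
qed

section \<open>Representatives of classes and the immersive topology\<close>

lemma pointed_lh_etale: "pointed_lh \<phi> \<Longrightarrow> etale Delta \<phi>" "pointed_lh \<phi> \<Longrightarrow> \<phi> 0 = 0"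
  unfolding pointed_lh_def using local_homeomorphism_iff_etale[of Delta] by auto

lemma surf_self:
  assumes "pointed_lh \<phi>" shows "\<phi> \<in> surf \<phi>"
proof -
  have "positive_at Delta (\<lambda>z. z) x" if x: "x \<in> Delta" for x
  proof -
    obtain r where "r > 0" "cball x r \<subseteq> Delta" using x Delta_simps(1) open_contains_cball by metis
    then show ?thesis by (intro positive_at_scale[of 1 r]) auto
  qed
  then have "orientation_preserving Delta (\<lambda>z. z)" unfolding orientation_preserving_iff by blast
  moreover have "homeomorphism Delta Delta (\<lambda>z. z) (\<lambda>z. z)" by (simp add: homeomorphism_def)
  ultimately show ?thesis using assms unfolding surf_def iso_plh_def by blast
qed

lemma surf_immersion:
  assumes "\<psi> \<in> surf \<phi>"
  obtains k where "immersion Delta \<psi> Delta \<phi> k" "inj_on k Delta"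
proof -
  obtain h k where hk: "homeomorphism Delta Delta h k" "h 0 = 0" "\<And>z. z \<in> Delta \<Longrightarrow> \<psi> z = \<phi> (k z)"
    using assms unfolding surf_def iso_plh_def by blast
  have "k 0 = 0" using homeomorphism_apply1[OF hk(1), of 0] hk(2) by simp
  then have "immersion Delta \<psi> Delta \<phi> k"
    using hk unfolding immersion_def homeomorphism_def by auto
  moreover have "inj_on k Delta" using homeomorphism_apply2[OF hk(1)] by (metis inj_onI)
  ultimately show ?thesis using that by blast
qed

text \<open>Reparametrisations between representatives are immersions, so composing with them lets
  one fixed representative decide.\<close>

lemma immerses_into_surf:
  assumes "pointed_lh \<phi>"
  shows "immerses_into A f (surf \<phi>) \<longleftrightarrow> (\<exists>\<iota>. immersion A f Delta \<phi> \<iota>)"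
  using surf_self[OF assms] surf_immersion immersion_compose unfolding immerses_into_def by metis

lemma embeds_into_surf:
  assumes "pointed_lh \<phi>"
  shows "embeds_into A f (surf \<phi>) \<longleftrightarrow> (\<exists>\<iota>. immersion A f Delta \<phi> \<iota> \<and> inj_on \<iota> A)"
proof
  assume "embeds_into A f (surf \<phi>)"
  then obtain \<psi> \<iota> where \<iota>: "\<psi> \<in> surf \<phi>" "immersion A f Delta \<psi> \<iota>" "inj_on \<iota> A"
    unfolding embeds_into_def by blast
  then obtain k where k: "immersion Delta \<psi> Delta \<phi> k" "inj_on k Delta" using surf_immersion by blast
  have "inj_on (k \<circ> \<iota>) A"
    using \<iota> k(2) unfolding immersion_def by (intro comp_inj_on) (auto intro: inj_on_subset)
  then show "\<exists>\<iota>. immersion A f Delta \<phi> \<iota> \<and> inj_on \<iota> A" using immersion_compose[OF \<iota>(2) k(1)] by blast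
qed (use surf_self[OF assms] in \<open>auto simp: embeds_into_def\<close>)

definition rep :: "(complex \<Rightarrow> complex) set \<Rightarrow> complex \<Rightarrow> complex" where
  "rep c = (SOME \<phi>. pointed_lh \<phi> \<and> c = surf \<phi>)"

lemma rep:
  assumes "c \<in> Mtilde" shows "pointed_lh (rep c)" "surf (rep c) = c"
proof -
  have "\<exists>\<phi>. pointed_lh \<phi> \<and> c = surf \<phi>" using assms unfolding Mtilde_def by blast
  then show "pointed_lh (rep c)" "surf (rep c) = c" unfolding rep_def by (metis (mono_tags, lifting) someI_ex)+
qed

lemma immerses_into_rep:
  assumes "c \<in> Mtilde"
  shows "immerses_into A f c \<longleftrightarrow> (\<exists>\<iota>. immersion A f Delta (rep c) \<iota>)"
    "embeds_into A f c \<longleftrightarrow> (\<exists>\<iota>. immersion A f Delta (rep c) \<iota> \<and> inj_on \<iota> A)"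
  using immerses_into_surf[OF rep(1)[OF assms]] embeds_into_surf[OF rep(1)[OF assms]] rep(2)[OF assms] by simp_all

text \<open>The generated topology lives on the union of the subbasis. A class belongs to it because
  the disk of radius \<open>1/2\<close> in a representative immerses by inclusion.\<close>

lemma topspace_immersive: "topspace immersive_topology = Mtilde"
proof -
  have "c \<in> \<Union> immersive_subbasis" if c: "c \<in> Mtilde" for c
  proof -
    let ?K = "cball (0::complex) (1/2)"
    have "?K \<in> closed_disks"
      unfolding closed_disks_def Delta_def
      by (auto intro!: convex_imp_path_connected homeomorphic_balls(2))
    moreover have "immersion ?K (rep c) Delta (rep c) (\<lambda>z. z)"
      unfolding immersion_def Delta_def by auto
    then have "immerses_into ?K (rep c) c" using immerses_into_rep[OF c] by blast
    ultimately show ?thesis using c rep(1)[OF c] unfolding immersive_subbasis_def by blast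
  qed
  then show ?thesis unfolding immersive_topology_def by (auto simp: topology_generated_by_topspace)
qed

text \<open>The definition prescribes only the homeomorphism type; invariance of domain gives the
  openness needed to restrict an \<open>etale\<close> map to \<open>U\<close>.\<close>

lemma open_disks_open: "U \<in> open_disks \<Longrightarrow> open U"
proof -
  assume "U \<in> open_disks"
  then obtain f g where "homeomorphism U (ball (0::complex) 1) f g"
    unfolding open_disks_def homeomorphic_def by blast
  then have g: "continuous_on (ball 0 1) g" "g ` ball 0 1 = U" "inj_on g (ball 0 1)"
    unfolding homeomorphism_def by (auto intro: inj_on_inverseI)
  then show ?thesis using invariance_of_domain by blast
qed

text \<open>Stated for a connected pointed domain \<open>A\<close> so that \<open>Delta\<close> with
  \<open>\<phi>\<close> and the ball of radius \<open>\<epsilon>\<close> with the inclusion are both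
  instances.\<close>

lemma compact_immersed:
  assumes A: "etale A f" "connected A" "0 \<in> A" "f 0 = 0"
  shows "compactin immersive_topology {c \<in> Mtilde. immerses_into A f c}"
  unfolding compactin_def
proof (intro conjI allI impI)
  show "{c \<in> Mtilde. immerses_into A f c} \<subseteq> topspace immersive_topology"
    unfolding topspace_immersive by blast
  define S where "S = {c \<in> Mtilde. immerses_into A f c}"
  fix \<U> assume "(\<forall>U\<in>\<U>. openin immersive_topology U) \<and> {c \<in> Mtilde. immerses_into A f c} \<subseteq> \<Union>\<U>"
  then have \<U>: "\<And>U. U \<in> \<U> \<Longrightarrow> openin immersive_topology U" "S \<subseteq> \<Union>\<U>" unfolding S_def by auto
  define fincov where "fincov T \<longleftrightarrow> (\<exists>\<F>. finite \<F> \<and> \<F> \<subseteq> \<U> \<and> T \<subseteq> \<Union>\<F>)" for T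
  have "fincov S"
  proof (rule ccontr)
    assume nc: "\<not> fincov S"
    have "\<exists>T. \<forall>n. (\<not> fincov (T n) \<and> T n \<subseteq> S) \<and>
      (T (Suc n) \<subseteq> T n \<and> (\<forall>c\<in>T (Suc n). \<forall>c'\<in>T (Suc n). pattern Delta (rep c) n = pattern Delta (rep c') n))"
    proof (rule dependent_nat_choice)
      show "\<exists>T. \<not> fincov T \<and> T \<subseteq> S" using nc by blast
      fix T :: "(complex \<Rightarrow> complex) set set" and n assume T: "\<not> fincov T \<and> T \<subseteq> S"
      define part where "part x = {c \<in> T. pattern Delta (rep c) n = x}" for x
      define X where "X = (\<lambda>c. pattern Delta (rep c) n) ` T"
      have "finite X" unfolding X_def by (rule finite_subset[OF _ finite_patterns[of n]]) auto
      \<comment> \<open>Only finitely many patterns occur at level \<open>n\<close>; were every part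
        finitely covered, these covers together would cover \<open>T\<close>.\<close>
      have "\<exists>x. \<not> fincov (part x)"
      proof (rule ccontr)
        assume "\<nexists>x. \<not> fincov (part x)"
        then obtain \<F> where \<F>: "\<And>x. finite (\<F> x)" "\<And>x. \<F> x \<subseteq> \<U>" "\<And>x. part x \<subseteq> \<Union>(\<F> x)"
          unfolding fincov_def by metis
        have "T \<subseteq> \<Union>(\<Union>x\<in>X. \<F> x)" 
        proof
          fix c assume c: "c \<in> T"
          then have "c \<in> part (pattern Delta (rep c) n)" "pattern Delta (rep c) n \<in> X"
            unfolding part_def X_def by auto
          then show "c \<in> \<Union>(\<Union>x\<in>X. \<F> x)" using \<F>(3) by blast
        qed
        moreover have "finite (\<Union>x\<in>X. \<F> x)" "(\<Union>x\<in>X. \<F> x) \<subseteq> \<U>"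
          using \<open>finite X\<close> \<F>(1) UN_least[OF \<F>(2)] by simp_all
        ultimately show False using T unfolding fincov_def by blast
      qed
      then obtain x where "\<not> fincov (part x)" by blast
      then show "\<exists>T'. (\<not> fincov T' \<and> T' \<subseteq> S) \<and>
        (T' \<subseteq> T \<and> (\<forall>c\<in>T'. \<forall>c'\<in>T'. pattern Delta (rep c) n = pattern Delta (rep c') n))"
        using T unfolding part_def by (intro exI[of _ "part x"]) (auto simp: part_def)
    qed
    then obtain T where T: "\<And>n. \<not> fincov (T n)" "\<And>n. T n \<subseteq> S" "\<And>n. T (Suc n) \<subseteq> T n"
      "\<And>n c c'. c \<in> T (Suc n) \<Longrightarrow> c' \<in> T (Suc n) \<Longrightarrow> pattern Delta (rep c) n = pattern Delta (rep c') n"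
      by metis
    have Tmono: "T n \<subseteq> T m" if "m \<le> n" for m n
      using that T(3) by (rule lift_Suc_antimono_le[rotated])
    \<comment> \<open>\<open>T (Suc k)\<close> fixes the pattern of level \<open>k\<close>, and so
      do the smaller later classes; hence the strict inequalities.\<close>
    have Tpat: "pattern Delta (rep c) k = pattern Delta (rep c') k" if "c \<in> T n" "c' \<in> T n'" "k < n" "k < n'" for c c' k n n'
      using T(4)[of c k c'] Tmono[of "Suc k" n] Tmono[of "Suc k" n'] that by auto
    have Tne: "T n \<noteq> {}" for n using T(1)[of n] unfolding fincov_def by auto
    have SM: "c \<in> Mtilde" if "c \<in> T n" for c n using that T(2) unfolding S_def by blast
    have Tet: "etale Delta (rep c)" "rep c 0 = 0" if "c \<in> T n" for c n
      using pointed_lh_etale rep(1)[OF SM[OF that]] by auto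
    \<comment> \<open>From level \<open>k0\<close> on, the region of \<open>A\<close>, and hence
      that of every surface receiving \<open>A\<close>, contains the basepoint.\<close>
    obtain k0 where k0: "0 \<in> region A f k0" using region_exhausts[OF A] A(3) by blast
    have z0: "0 \<in> region Delta (rep c) k" if c: "c \<in> T n" and k: "k0 \<le> k" for c n k
    proof -
      obtain \<iota> where \<iota>: "immersion A f Delta (rep c) \<iota>"
        using c T(2) immerses_into_rep(1)[OF SM[OF c]] unfolding S_def by blast
      then have "\<iota> 0 \<in> region Delta (rep c) k0"
        using region_push[OF \<iota> Tet(1)[OF c]] k0 by blast
      then show ?thesis using \<iota> region_mono[OF k] unfolding immersion_def by auto
    qed
    obtain N where N: "\<And>k. k < N k" "\<And>k p. etale Delta p \<Longrightarrow>
        closure (region Delta p k \<union> inside (region Delta p k)) \<subseteq> region Delta p (N k)"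
      using fill_region by metis
    define \<kappa> where "\<kappa> i = (N ^^ i) k0" for i
    have \<kappa>: "\<kappa> 0 = k0" "\<kappa> (Suc i) = N (\<kappa> i)" "\<kappa> i < \<kappa> (Suc i)" for i
      unfolding \<kappa>_def using N(1) by auto
    have \<kappa>mono: "strict_mono \<kappa>" using \<kappa>(3) by (simp add: strict_mono_Suc_iff)
    have \<kappa>k0: "k0 \<le> \<kappa> i" for i using \<kappa>(1) strict_mono_less_eq[OF \<kappa>mono, of 0 i] by simp
    have "\<forall>i. \<exists>c. c \<in> T (Suc (\<kappa> (Suc i)))" using Tne by blast
    \<comment> \<open>\<open>Q i\<close> and all later \<open>Q j\<close> share the pattern of level
      \<open>\<kappa> (Suc i)\<close>, whose region contains the filling of level
      \<open>\<kappa> i\<close>.\<close>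
    then obtain Q where Q: "\<And>i. Q i \<in> T (Suc (\<kappa> (Suc i)))" by metis
    define \<psi> where "\<psi> i = rep (Q i)" for i
    define W where "W i = region Delta (\<psi> i) (\<kappa> i)" for i
    define V where "V i = region Delta (\<psi> i) (\<kappa> (Suc i))" for i
    \<comment> \<open>The filling gives \<open>\<Omega> i \<subseteq> V i\<close>, and the common
      pattern embeds \<open>V i\<close> into \<open>W (Suc i)\<close>: the holes of one stage are
      settled inside the swept region of the next.\<close>
    define \<Omega> where "\<Omega> i = W i \<union> inside (W i)" for i
    have \<psi>: "etale Delta (\<psi> i)" "\<psi> i 0 = 0" for i using Tet[OF Q] unfolding \<psi>_def by auto
    have W: "open (W i)" "connected (W i)" "bounded (W i)" "0 \<in> W i" for i
      using connected_region[OF \<psi>(1)] region_subset bounded_subset[OF Delta_simps(3)] z0[OF Q \<kappa>k0]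
      unfolding W_def \<psi>_def by auto
    have cl: "closure (\<Omega> i) \<subseteq> V i" for i
      using N(2)[OF \<psi>(1)] unfolding \<Omega>_def W_def V_def \<kappa>(2) by blast
    then have \<Omega>V: "\<Omega> i \<subseteq> V i" for i using closure_subset by blast
    have VD: "V i \<subseteq> Delta" for i unfolding V_def by (rule region_subset)
    have \<Omega>: "open (\<Omega> i)" "0 \<in> \<Omega> i" "\<Omega> i homeomorphic ball (0::complex) 1" for i
    proof -
      have sc: "open (\<Omega> i)" "simply_connected (\<Omega> i)"
        using simply_connected_fill[OF W(1-3)] unfolding \<Omega>_def by auto
      show "open (\<Omega> i)" by (rule sc)
      show "0 \<in> \<Omega> i" using W(4) unfolding \<Omega>_def by blast
      then show "\<Omega> i homeomorphic ball (0::complex) 1"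
        using simply_connected_eq_homeomorphic_to_disc[OF sc(1)] sc(2) by blast
    qed
    have \<Omega>et: "etale (\<Omega> i) (\<psi> i)" for i
      using etale_subset[OF \<psi>(1) \<Omega>(1)] \<Omega>V VD by blast
    have V0: "0 \<in> V i" for i using \<Omega>V \<Omega>(2) by blast
    have "\<exists>e. immersion (V i) (\<psi> i) (W (Suc i)) (\<psi> (Suc i)) e \<and> inj_on e (V i)" for i
    proof -
      have "\<kappa> (Suc i) < Suc (\<kappa> (Suc (Suc i)))" using \<kappa>(3) less_SucI by blast
      then have "pattern Delta (\<psi> i) (\<kappa> (Suc i)) = pattern Delta (\<psi> (Suc i)) (\<kappa> (Suc i))"
        using Tpat[OF Q Q] unfolding \<psi>_def by blast
      then show ?thesis
        using pattern_embedding[OF \<psi>(1) \<psi>(1) _ V0[unfolded V_def]] unfolding V_def W_def by metis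
    qed
    then obtain e where e: "\<And>i. immersion (V i) (\<psi> i) (W (Suc i)) (\<psi> (Suc i)) (e i)" "\<And>i. inj_on (e i) (V i)"
      by metis
    have eV: "e i ` V i \<subseteq> W (Suc i)" for i using e(1) unfolding immersion_def by blast
    have W\<Omega>: "W i \<subseteq> \<Omega> i" for i unfolding \<Omega>_def by blast
    have e\<Omega>: "immersion (\<Omega> i) (\<psi> i) (\<Omega> (Suc i)) (\<psi> (Suc i)) (e i)" for i
      using immersion_mono[OF e(1) \<Omega>V] eV \<Omega>V W\<Omega> by (meson image_mono order_trans)
    have ei: "inj_on (e i) (\<Omega> i)" for i using inj_on_subset[OF e(2) \<Omega>V] .
    have rc: "\<exists>K. compact K \<and> e i ` \<Omega> i \<subseteq> K \<and> K \<subseteq> \<Omega> (Suc i)" for i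
    proof (intro exI conjI)
      have "bounded (\<Omega> i)" using bounded_subset[OF Delta_simps(3)] \<Omega>V VD by (meson order_trans)
      then have "compact (closure (\<Omega> i))" by (simp add: compact_closure)
      moreover have "continuous_on (closure (\<Omega> i)) (e i)"
        using e(1) continuous_on_subset[OF _ cl] unfolding immersion_def by blast
      ultimately show "compact (e i ` closure (\<Omega> i))" by (rule compact_continuous_image[rotated])
      show "e i ` \<Omega> i \<subseteq> e i ` closure (\<Omega> i)" by (intro image_mono closure_subset)
      show "e i ` closure (\<Omega> i) \<subseteq> \<Omega> (Suc i)" using cl eV W\<Omega> by (meson image_mono order_trans)
    qed
    obtain \<Phi> where \<Phi>: "pointed_lh \<Phi>"
      and inner: "\<And>r. r < 1 \<Longrightarrow> \<exists>i \<iota>. immersion (ball 0 r) \<Phi> (\<Omega> i) (\<psi> i) \<iota> \<and> inj_on \<iota> (ball 0 r)"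
      and outer: "\<And>i. \<exists>\<iota>. immersion (\<Omega> i) (\<psi> i) Delta \<Phi> \<iota> \<and> inj_on \<iota> (\<Omega> i)"
      by (rule limit_surface[where \<Omega> = \<Omega> and \<psi> = \<psi> and e = e, OF \<Omega>et \<psi>(2) \<Omega>(2,3) e\<Omega> ei rc]) blast
    \<comment> \<open>Passage to the limit: whatever maps into members of all the \<open>T n\<close>
      maps into \<open>\<Phi>\<close>, with \<open>J\<close> demanding injectivity
      throughout.\<close>
    have limit: "\<exists>\<iota>. immersion B g Delta \<Phi> \<iota> \<and> (J \<longrightarrow> inj_on \<iota> B)"
      if B: "etale B g" "connected B" "0 \<in> B" "g 0 = 0"
        and ex: "\<And>n. \<exists>c\<in>T n. \<exists>\<iota>. immersion B g Delta (rep c) \<iota> \<and> (J \<longrightarrow> inj_on \<iota> B)" for B g J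
    proof -
      have "\<exists>p q \<iota> j. etale Delta p \<and> etale Delta q \<and> immersion B g Delta p \<iota> \<and> (J \<longrightarrow> inj_on \<iota> B) \<and>
         pattern Delta p k = pattern Delta q k \<and>
         immersion (region Delta q k) q Delta \<Phi> j \<and> inj_on j (region Delta q k)" for k
      proof -
        obtain c \<iota> where c: "c \<in> T (Suc k)" "immersion B g Delta (rep c) \<iota>" "J \<longrightarrow> inj_on \<iota> B"
          using ex by blast
        \<comment> \<open>Because of this the region of level \<open>k\<close> of
          \<open>\<psi> k\<close> lies in \<open>\<Omega> k\<close> and so embeds into the
          limit.\<close>
        have k: "k \<le> \<kappa> k" using strict_mono_imp_increasing[OF \<kappa>mono] .
        then have "k < Suc (\<kappa> (Suc k))" using \<kappa>(3)[of k] by simp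
        then have pat: "pattern Delta (rep c) k = pattern Delta (\<psi> k) k"
          using Tpat[OF c(1) Q] unfolding \<psi>_def by blast
        obtain j where j: "immersion (\<Omega> k) (\<psi> k) Delta \<Phi> j" "inj_on j (\<Omega> k)" using outer by blast
        have sub: "region Delta (\<psi> k) k \<subseteq> \<Omega> k"
          using region_mono[OF k] W\<Omega>[of k] unfolding W_def by blast
        have "immersion (region Delta (\<psi> k) k) (\<psi> k) Delta \<Phi> j"
          by (rule immersion_mono[OF j(1) sub]) (use j(1) sub in \<open>auto simp: immersion_def\<close>)
        then show ?thesis
          using c Tet(1)[OF c(1)] \<psi>(1)[of k] pat inj_on_subset[OF j(2) sub] by blast
      qed
      then show ?thesis using glue_levels[OF B pointed_lh_etale(1)[OF \<Phi>], of J] by metis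
    qed
    have \<Phi>M: "surf \<Phi> \<in> Mtilde" using \<Phi> unfolding Mtilde_def by blast
    have "\<exists>\<iota>. immersion A f Delta \<Phi> \<iota> \<and> (False \<longrightarrow> inj_on \<iota> A)"
    proof (rule limit[OF A])
      fix n
      obtain c where c: "c \<in> T n" using Tne by blast
      then have "immerses_into A f c" using T(2) unfolding S_def by blast
      then show "\<exists>c\<in>T n. \<exists>\<iota>. immersion A f Delta (rep c) \<iota> \<and> (False \<longrightarrow> inj_on \<iota> A)"
        using c immerses_into_rep(1)[OF SM[OF c]] by blast
    qed
    then have "surf \<Phi> \<in> S" using immerses_into_surf[OF \<Phi>] \<Phi>M unfolding S_def by blast
    then obtain O' where O': "O' \<in> \<U>" "surf \<Phi> \<in> O'" using \<U>(2) by blast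
    then obtain G where G: "generate_topology_on immersive_subbasis G" "O' = G \<inter> Mtilde"
      using \<U>(1) unfolding immersive_topology_def openin_subtopology openin_topology_generated_by_iff by blast
    \<comment> \<open>Every open set around the limit contains some \<open>T n\<close>. Nestedness
      handles intersections; the work is in the subbasic sets.\<close>
    have "\<exists>n. T n \<subseteq> G" if "surf \<Phi> \<in> G" using G(1) that
    proof (induction rule: generate_topology_on.induct)
      case (Int a b)
      then obtain m n where "T m \<subseteq> a" "T n \<subseteq> b" by blast
      then show ?case using Tmono[of m "max m n"] Tmono[of n "max m n"] by (intro exI[of _ "max m n"]) auto
    next
      case (Basis G)
      then consider (immerse) \<phi> K where "G = {c \<in> Mtilde. immerses_into K \<phi> c}" "pointed_lh \<phi>" "K \<in> closed_disks"
        | (embed) \<phi> U where "G = {c \<in> Mtilde. \<not> embeds_into U \<phi> c}" "pointed_lh \<phi>" "U \<in> open_disks"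
        unfolding immersive_subbasis_def by blast
      then show ?case
      proof cases
        case immerse
        \<comment> \<open>The image of \<open>K\<close> in the limit is compact, so it lies in a
          ball of radius \<open>r < 1\<close> and thereby maps into a stage \<open>V i\<close>,
          which embeds into every surface of \<open>T (Suc (\<kappa> (Suc i)))\<close>.\<close>
        obtain \<iota> where \<iota>: "immersion K \<phi> Delta \<Phi> \<iota>"
          using Basis immerse immerses_into_surf[OF \<Phi>] by blast
        have "compact K"
          using immerse(3) homeomorphic_compactness[of K "cball (0::complex) 1"] unfolding closed_disks_def by auto
        then have "compact (\<iota> ` K)" using \<iota> compact_continuous_image unfolding immersion_def by blast
        moreover have "\<iota> ` K \<noteq> {}" using immerse(3) unfolding closed_disks_def by auto
        ultimately obtain m where m: "m \<in> \<iota> ` K" "\<And>y. y \<in> \<iota> ` K \<Longrightarrow> norm y \<le> norm m"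
          using continuous_attains_sup[of "\<iota> ` K" norm] by (auto intro: continuous_intros)
        have "m \<in> Delta" using m(1) \<iota> unfolding immersion_def by blast
        then have "norm m < 1" unfolding Delta_def by simp
        then obtain r where r: "norm m < r" "r < 1" using dense by blast
        obtain i j where j: "immersion (ball 0 r) \<Phi> (\<Omega> i) (\<psi> i) j" using inner[OF r(2)] by blast
        have "\<iota> ` K \<subseteq> ball 0 r" using m(2) r(1) by fastforce
        then have i1: "immersion K \<phi> (ball 0 r) \<Phi> \<iota>" using immersion_mono[OF \<iota> order_refl] by blast
        have "j ` ball 0 r \<subseteq> V i" using j \<Omega>V unfolding immersion_def by blast
        then have i2: "immersion (ball 0 r) \<Phi> (V i) (\<psi> i) j" using immersion_mono[OF j order_refl] by blast
        have "T (Suc (\<kappa> (Suc i))) \<subseteq> G"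
        proof
          fix c assume c: "c \<in> T (Suc (\<kappa> (Suc i)))"
          have "pattern Delta (\<psi> i) (\<kappa> (Suc i)) = pattern Delta (rep c) (\<kappa> (Suc i))"
            using Tpat[OF Q c] unfolding \<psi>_def by blast
          then obtain e' where "immersion (V i) (\<psi> i) (region Delta (rep c) (\<kappa> (Suc i))) (rep c) e'"
            using pattern_embedding[OF \<psi>(1) Tet(1)[OF c] _ V0[unfolded V_def]] unfolding V_def by metis
          then have "immersion (V i) (\<psi> i) Delta (rep c) e'"
            using immersion_mono[OF _ order_refl] region_subset unfolding immersion_def by (meson order_trans)
          then have "immersion K \<phi> Delta (rep c) (e' \<circ> (j \<circ> \<iota>))"
            using immersion_compose[OF immersion_compose[OF i1 i2]] by blast
          then show "c \<in> G" using immerse(1) SM[OF c] immerses_into_rep(1)[OF SM[OF c]] by blast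
        qed
        then show ?thesis by blast
      next
        case embed
        have U: "open U" "U \<subseteq> Delta" "connected U" "0 \<in> U"
          using open_disks_open[OF embed(3)] embed(3) path_connected_imp_connected unfolding open_disks_def by auto
        show ?thesis
        proof (rule ccontr)
          \<comment> \<open>If every \<open>T n\<close> contained a surface into which
            \<open>U\<close> embeds, these embeddings would produce one into the limit, which by
            assumption admits none.\<close>
          assume no: "\<nexists>n. T n \<subseteq> G"
          have "\<exists>\<iota>. immersion U \<phi> Delta \<Phi> \<iota> \<and> (True \<longrightarrow> inj_on \<iota> U)"
          proof (rule limit)
            show "etale U \<phi>" using etale_subset[OF pointed_lh_etale(1)[OF embed(2)] U(1,2)] .
            fix n
            obtain c where c: "c \<in> T n" "c \<notin> G" using no by blast
            then have "embeds_into U \<phi> c" using embed(1) SM by blast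
            then show "\<exists>c\<in>T n. \<exists>\<iota>. immersion U \<phi> Delta (rep c) \<iota> \<and> (True \<longrightarrow> inj_on \<iota> U)"
              using c(1) immerses_into_rep(2)[OF SM[OF c(1)]] by blast
          qed (use U pointed_lh_etale(2)[OF embed(2)] in auto)
          then have "embeds_into U \<phi> (surf \<Phi>)" using embeds_into_surf[OF \<Phi>] by blast
          then show False using Basis embed(1) by blast
        qed
      qed
    qed blast+
    then obtain n where "T n \<subseteq> G" using O'(2) G(2) by blast
    then have "T n \<subseteq> O'" using SM G(2) by blast
    then have "fincov (T n)" using O'(1) unfolding fincov_def by (intro exI[of _ "{O'}"]) auto
    then show False using T(1) by blast
  qed
  then show "\<exists>\<F>. finite \<F> \<and> \<F> \<subseteq> \<U> \<and> {c \<in> Mtilde. immerses_into A f c} \<subseteq> \<Union>\<F>"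
    unfolding fincov_def S_def .
qed

theorem mainTheorem10:
  shows "(\<forall>\<phi>. pointed_lh \<phi> \<longrightarrow>
            compactin immersive_topology {c \<in> Mtilde. immerses_into Delta \<phi> c}) \<and>
         (\<forall>\<epsilon>::real. \<epsilon> > 0 \<longrightarrow>
            compactin immersive_topology {c \<in> Mtilde. immerses_into (ball 0 \<epsilon>) (\<lambda>z. z) c})"
proof (intro conjI allI impI)
  show "compactin immersive_topology {c \<in> Mtilde. immerses_into Delta \<phi> c}" if "pointed_lh \<phi>" for \<phi>
    using compact_immersed[OF pointed_lh_etale(1)[OF that]] pointed_lh_etale(2)[OF that] by simp
next
  fix \<epsilon> :: real assume "\<epsilon> > 0"
  moreover have "etale (ball 0 \<epsilon>) (\<lambda>z. z)"
    unfolding etale_def by (auto intro!: exI[of _ "ball 0 \<epsilon>"])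
  ultimately show "compactin immersive_topology {c \<in> Mtilde. immerses_into (ball 0 \<epsilon>) (\<lambda>z. z) c}"
    using compact_immersed[of "ball 0 \<epsilon>" "\<lambda>z. z"] by simp
qed

end
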